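(* Let $T$ be the tree generated by a test and let $\xi<\omega_1$. Then the set $[T]\setminus S_{1+\xi}$ is in $\mathbf{\Pi}^0_{1+\xi}(2^\omega\times 2^\omega)$ but is not $\mathrm{pot}(\mathbf{\Sigma}^0_{1+\xi})$, and $S_{1+\xi}$ is not $\mathrm{pot}(\mathbf{\Pi}^0_{1+\xi})$.
   Context: Let $\langle n,p\rangle:=\left(\sum_{k\leq n+p}k\right)+p$ (a bijection $\omega^2\to\omega$), with inverse $q\mapsto((q)_0,(q)_1)$. A set $E\subseteq\bigcup_{q}2^q\times 2^q$ is a test if: (a) for each $q$ there is a unique $(s_q,t_q)\in E\cap(2^q\times 2^q)$; (b) for all $m,p\in\omega$ and $u\in 2^{<\omega}$ there is $v\in 2^{<\omega}$ with $(s_p0uv,t_p1uv)\in E$ and $(|t_p1uv|-1)_0=m$; (c) for each $n>0$ there are $q<n$ and $w$ with $s_n=s_q0w$, $t_n=t_q1w$. The tree generated by $E$ is $T:=\{(s,t): s=t=\emptyset$ or $\exists q\,\exists w\ (s,t)=(s_q0w,t_q1w)\}$; $[T]$ is its set of infinite branches in $2^\omega\times 2^\omega$. Define $\rho_0:2^\omega\to 2^\omega$ by $\rho_0(\varepsilon)(i)=1$ iff $\varepsilon(\langle i,j\rangle)=0$ for all $j$. Define $\rho_0^\xi$ for $\xi<\omega_1$: $\rho_0^0=\mathrm{Id}$, $\rho_0^{\eta+1}=\rho_0\circ\rho_0^\eta$; for limit $\lambda>0$ fix ordinals $(\xi^\lambda_k)_k\subseteq\lambda\setminus\{0\}$ with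 $\sum_k\xi^\lambda_k=\lambda$, let $(\varepsilon)^k(i):=\varepsilon(i+k)$, define $\rho_0^{(k,k+1)}(\varepsilon)(i):=\varepsilon(i)$ for $i<k$ and $:=\rho_0^{\xi^\lambda_k}((\varepsilon)^k)(i-k)$ for $i\geq k$, let $\rho_0^{(0,k+1)}:=\rho_0^{(k,k+1)}\circ\dots\circ\rho_0^{(0,1)}$, and $\rho_0^\lambda(\varepsilon)(k):=\rho_0^{(0,k+1)}(\varepsilon)(k)$. Put $H_{1+\xi}:=(\rho_0^\xi)^{-1}(\{0^\infty\})$. Let $\mathcal S:2^\omega\to 2^\omega$ be the shift $\mathcal S(\alpha)(m)=\alpha(m+1)$ and $\alpha\,\Delta\,\beta$ the symmetric difference ($(\alpha\Delta\beta)(m)=1$ iff $\alpha(m)\neq\beta(m)$). Set $S_{1+\xi}:=\{(\alpha,\beta)\in[T]:\mathcal S(\alpha\,\Delta\,\beta)\notin H_{1+\xi}\}$. A Borel set $A\subseteq X\times Y$ is $\mathrm{pot}(\Gamma)$ if there are finer Polish topologies $\sigma$ on $X$, $\tau$ on $Y$ with $A\in\Gamma([X,\sigma]\times[Y,\tau])$. *)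

theory Defs
  imports "HOL-Analysis.Analysis"
begin

text \<open>Binary sequences are bool-valued: True = 1, False = 0.\<close>

definition pair :: "nat \<Rightarrow> nat \<Rightarrow> nat" where
  "pair n p = (\<Sum>k\<le>n+p. k) + p"

definition unpair0 :: "nat \<Rightarrow> nat" where
  "unpair0 q = (THE n. \<exists>p. pair n p = q)"

definition cantor_top :: "(nat \<Rightarrow> bool) topology" where
  "cantor_top = product_topology (\<lambda>_::nat. discrete_topology (UNIV::bool set)) UNIV"

definition Polish_space :: "'a topology \<Rightarrow> bool" where
  "Polish_space X \<longleftrightarrow> completely_metrizable_space X \<and> separable_space X"

definition sq :: "(bool list \<times> bool list) set \<Rightarrow> nat \<Rightarrow> bool list" where
  "sq E q = fst (THE p. p \<in> E \<and> length (fst p) = q \<and> length (snd p) = q)"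

definition tq :: "(bool list \<times> bool list) set \<Rightarrow> nat \<Rightarrow> bool list" where
  "tq E q = snd (THE p. p \<in> E \<and> length (fst p) = q \<and> length (snd p) = q)"

definition is_test :: "(bool list \<times> bool list) set \<Rightarrow> bool" where
  "is_test E \<longleftrightarrow>
     E \<subseteq> {(s, t). length s = length t}
   \<and> (\<forall>q. \<exists>!p. p \<in> E \<and> length (fst p) = q \<and> length (snd p) = q)
   \<and> (\<forall>m p u. \<exists>v. (sq E p @ [False] @ u @ v, tq E p @ [True] @ u @ v) \<in> E
                 \<and> unpair0 (length (tq E p @ [True] @ u @ v) - 1) = m)
   \<and> (\<forall>n>0. \<exists>q<n. \<exists>w. sq E n = sq E q @ False # w \<and> tq E n = tq E q @ True # w)"

definition test_tree :: "(bool list \<times> bool list) set \<Rightarrow> (bool list \<times> bool list) set" where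
  "test_tree E = {(s, t). (s = [] \<and> t = []) \<or>
                          (\<exists>q w. s = sq E q @ False # w \<and> t = tq E q @ True # w)}"

definition body :: "(bool list \<times> bool list) set \<Rightarrow> ((nat \<Rightarrow> bool) \<times> (nat \<Rightarrow> bool)) set" where
  "body T = {(\<alpha>, \<beta>). \<forall>n. (map \<alpha> [0..<n], map \<beta> [0..<n]) \<in> T}"

text \<open>Countable ordinals are represented by elements of an arbitrary wellorder type
  whose initial segments are countable; an element \<xi> stands for the order type of
  the set of its predecessors.\<close>

definition is_zero :: "'o::wellorder \<Rightarrow> bool" where
  "is_zero \<xi> \<longleftrightarrow> (\<forall>\<zeta>. \<not> \<zeta> < \<xi>)"

definition is_succ :: "'o::wellorder \<Rightarrow> bool" where
  "is_succ \<xi> \<longleftrightarrow> (\<exists>\<eta><\<xi>. \<forall>\<zeta><\<xi>. \<zeta> \<le> \<eta>)"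

definition opred :: "'o::wellorder \<Rightarrow> 'o" where
  "opred \<xi> = (THE \<eta>. \<eta> < \<xi> \<and> (\<forall>\<zeta><\<xi>. \<zeta> \<le> \<eta>))"

definition is_limit :: "'o::wellorder \<Rightarrow> bool" where
  "is_limit \<xi> \<longleftrightarrow> \<not> is_zero \<xi> \<and> \<not> is_succ \<xi>"

text \<open>Infinite ordinal sum: \<open>\<Sum>\<^sub>k f k = \<lambda>\<close>, i.e. the lexicographically ordered
  disjoint union of the (sets of predecessors of) \<open>f k\<close> is order isomorphic to
  the predecessors of \<lambda>.\<close>

definition osum_eq :: "(nat \<Rightarrow> 'o::wellorder) \<Rightarrow> 'o \<Rightarrow> bool" where
  "osum_eq f l \<longleftrightarrow> (\<exists>h. bij_betw h {(k, \<eta>). \<eta> < f k} {..<l} \<and>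
     (\<forall>k \<eta> k' \<eta>'. \<eta> < f k \<longrightarrow> \<eta>' < f k' \<longrightarrow> (k < k' \<or> (k = k' \<and> \<eta> < \<eta>'))
         \<longrightarrow> h (k, \<eta>) < h (k', \<eta>')))"

definition good_seq :: "('o::wellorder \<Rightarrow> nat \<Rightarrow> 'o) \<Rightarrow> 'o \<Rightarrow> bool" where
  "good_seq seq \<xi> \<longleftrightarrow> (\<forall>l\<le>\<xi>. is_limit l \<longrightarrow>
      (\<forall>k. \<not> is_zero (seq l k) \<and> seq l k < l) \<and> osum_eq (seq l) l)"

definition rho0 :: "(nat \<Rightarrow> bool) \<Rightarrow> nat \<Rightarrow> bool" where
  "rho0 \<epsilon> i \<longleftrightarrow> (\<forall>j. \<not> \<epsilon> (pair i j))"

primrec lim_stage :: "(nat \<Rightarrow> (nat \<Rightarrow> bool) \<Rightarrow> nat \<Rightarrow> bool) \<Rightarrow> (nat \<Rightarrow> bool) \<Rightarrow> nat \<Rightarrow> nat \<Rightarrow> bool" where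
  "lim_stage F \<epsilon> 0 = \<epsilon>"
| "lim_stage F \<epsilon> (Suc k) =
     (\<lambda>i. if i < k then lim_stage F \<epsilon> k i
          else F k (\<lambda>j. lim_stage F \<epsilon> k (j + k)) (i - k))"

definition rho_step ::
  "('o::wellorder \<Rightarrow> nat \<Rightarrow> 'o) \<Rightarrow> ('o \<Rightarrow> (nat \<Rightarrow> bool) \<Rightarrow> nat \<Rightarrow> bool) \<Rightarrow> 'o \<Rightarrow> (nat \<Rightarrow> bool) \<Rightarrow> nat \<Rightarrow> bool" where
  "rho_step seq R \<xi> =
     (if is_zero \<xi> then id
      else if is_succ \<xi> then rho0 \<circ> R (opred \<xi>)
      else (\<lambda>\<epsilon> k. lim_stage (\<lambda>k. R (seq \<xi> k)) \<epsilon> (Suc k) k))"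

definition rho :: "('o::wellorder \<Rightarrow> nat \<Rightarrow> 'o) \<Rightarrow> 'o \<Rightarrow> (nat \<Rightarrow> bool) \<Rightarrow> nat \<Rightarrow> bool" where
  "rho seq = wfrec {(x, y). x < y} (rho_step seq)"

text \<open>\<open>H seq \<xi>\<close> is \<open>H_{1+\<xi>}\<close>.\<close>

definition H :: "('o::wellorder \<Rightarrow> nat \<Rightarrow> 'o) \<Rightarrow> 'o \<Rightarrow> (nat \<Rightarrow> bool) set" where
  "H seq \<xi> = {\<epsilon>. rho seq \<xi> \<epsilon> = (\<lambda>_. False)}"

definition shift :: "(nat \<Rightarrow> bool) \<Rightarrow> nat \<Rightarrow> bool" where
  "shift \<alpha> m = \<alpha> (m + 1)"

definition symdiff :: "(nat \<Rightarrow> bool) \<Rightarrow> (nat \<Rightarrow> bool) \<Rightarrow> nat \<Rightarrow> bool" where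
  "symdiff \<alpha> \<beta> m \<longleftrightarrow> \<alpha> m \<noteq> \<beta> m"

text \<open>\<open>S_set seq E \<xi>\<close> is \<open>S_{1+\<xi>}\<close>.\<close>

definition S_set :: "('o::wellorder \<Rightarrow> nat \<Rightarrow> 'o) \<Rightarrow> (bool list \<times> bool list) set \<Rightarrow> 'o
                     \<Rightarrow> ((nat \<Rightarrow> bool) \<times> (nat \<Rightarrow> bool)) set" where
  "S_set seq E \<xi> = {(\<alpha>, \<beta>) \<in> body (test_tree E). shift (symdiff \<alpha> \<beta>) \<notin> H seq \<xi>}"

text \<open>\<open>sigma0 X \<xi>\<close> is \<open>\<Sigma>^0_{1+\<xi>}(X)\<close>, \<open>pi0 X \<xi>\<close> is \<open>\<Pi>^0_{1+\<xi>}(X)\<close>.\<close>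

definition sigma_step :: "'a topology \<Rightarrow> ('o::wellorder \<Rightarrow> 'a set set) \<Rightarrow> 'o \<Rightarrow> 'a set set" where
  "sigma_step X S \<xi> =
     (if is_zero \<xi> then {U. openin X U}
      else {\<Union>(range A) | A. \<forall>n::nat. \<exists>\<eta><\<xi>. A n \<in> (\<lambda>B. topspace X - B) ` S \<eta>})"

definition sigma0 :: "'a topology \<Rightarrow> 'o::wellorder \<Rightarrow> 'a set set" where
  "sigma0 X = wfrec {(x, y). x < y} (sigma_step X)"

definition pi0 :: "'a topology \<Rightarrow> 'o::wellorder \<Rightarrow> 'a set set" where
  "pi0 X \<xi> = (\<lambda>B. topspace X - B) ` sigma0 X \<xi>"

definition finer :: "'a topology \<Rightarrow> 'a topology \<Rightarrow> bool" where
  "finer \<sigma> X \<longleftrightarrow> topspace \<sigma> = topspace X \<and> (\<forall>U. openin X U \<longrightarrow> openin \<sigma> U)"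

definition pot :: "(('a \<times> 'b) topology \<Rightarrow> ('a \<times> 'b) set set) \<Rightarrow> 'a topology \<Rightarrow> 'b topology
                   \<Rightarrow> ('a \<times> 'b) set \<Rightarrow> bool" where
  "pot \<Gamma> X Y A \<longleftrightarrow> (\<exists>\<sigma> \<tau>. Polish_space \<sigma> \<and> Polish_space \<tau> \<and> finer \<sigma> X \<and> finer \<tau> Y
                          \<and> A \<in> \<Gamma> (prod_topology \<sigma> \<tau>))"

end

theory Submission
  imports Defs
begin

text \<open>
  Given finer Polish topologies, remove a meager set so that they agree with the usual one on a
  dense \<open>G\<^sub>\<delta>\<close> set \<open>C\<close>. Condition (b) of a test lets a branch \<open>(\<alpha>, \<beta>)\<close> of the tree stay in
  \<open>C \<times> C\<close> while its difference receives a new 1 in any prescribed column \<open>m\<close>, at a position that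
  cannot be controlled. As \<open>\<rho>\<^sub>0\<close> only sees which columns contain a 1, this yields a continuous
  \<open>f : 2\<^sup>\<omega> \<rightarrow> [T] \<inter> (C \<times> C)\<close> with \<open>f\<^sup>-\<^sup>1([T] - S) = H\<close>, and it remains to see that \<open>H\<close> is not
  \<open>\<Sigma>\<^sup>0\<^bsub>1+\<xi>\<^esub>\<close>. By induction on \<open>\<xi>\<close>, every \<open>\<Pi>\<^sup>0\<^bsub>1+\<xi>\<^esub>\<close> set \<open>P\<close> is \<open>g\<^sup>-\<^sup>1(H)\<close> for a map \<open>g\<close> such that the
  \<open>i\<close>-th bit of \<open>g(z)\<close> depends only on the first \<open>i\<close> bits of \<open>z\<close>. Such a \<open>g\<close> has a fixed point, which
  belongs to \<open>P\<close> iff it belongs to \<open>H\<close>, so \<open>P\<close> is not the complement of \<open>H\<close>.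
\<close>


section \<open>The Cantor space and the Borel hierarchy\<close>

lemma topspace_cantor [simp]: "topspace cantor_top = UNIV"
  by (simp add: cantor_top_def)

lemma openin_cantor_iff:
  "openin cantor_top U \<longleftrightarrow> (\<forall>x\<in>U. \<exists>n. \<forall>y. (\<forall>i<n. y i = x i) \<longrightarrow> y \<in> U)" (is "?l \<longleftrightarrow> ?r")
proof
  assume ?l
  show ?r
  proof
    fix x assume "x \<in> U"
    with \<open>?l\<close> obtain V where V: "finite {i. V i \<noteq> (UNIV::bool set)}" "x \<in> Pi\<^sub>E UNIV V" "Pi\<^sub>E UNIV V \<subseteq> U"
      unfolding cantor_top_def openin_product_topology_alt by force
    obtain n where n: "\<forall>i\<in>{i. V i \<noteq> UNIV}. i < n"
      using V(1) finite_nat_set_iff_bounded by blast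
    have "y \<in> U" if "\<forall>i<n. y i = x i" for y
    proof -
      have "y i \<in> V i" for i
      proof (cases "i < n")
        case True
        then show ?thesis using that V(2) by (auto simp: PiE_iff)
      next
        case False
        with n show ?thesis by auto
      qed
      then show ?thesis using V(3) by auto
    qed
    then show "\<exists>n. \<forall>y. (\<forall>i<n. y i = x i) \<longrightarrow> y \<in> U" by blast
  qed
next
  assume r: ?r
  show ?l
    unfolding cantor_top_def openin_product_topology_alt
  proof
    fix x assume "x \<in> U"
    with r obtain n where n: "\<forall>y. (\<forall>i<n. y i = x i) \<longrightarrow> y \<in> U" by blast
    let ?V = "\<lambda>i. if i < n then {x i} else UNIV"
    have "{i. ?V i \<noteq> UNIV} \<subseteq> {..<n}" by auto
    then have "finite {i. ?V i \<noteq> UNIV}" using finite_subset by blast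
    moreover have "Pi\<^sub>E UNIV ?V \<subseteq> U"
    proof
      fix y assume y: "y \<in> Pi\<^sub>E UNIV ?V"
      have "y i = x i" if "i < n" for i
        using PiE_mem[OF y UNIV_I, of i] that by simp
      with n show "y \<in> U" by blast
    qed
    moreover have "x \<in> Pi\<^sub>E UNIV ?V" by (auto simp: PiE_iff)
    ultimately show "\<exists>V. finite {i \<in> UNIV. V i \<noteq> topspace (discrete_topology (UNIV::bool set))} \<and>
        (\<forall>i\<in>UNIV. openin (discrete_topology UNIV) (V i)) \<and> x \<in> Pi\<^sub>E UNIV V \<and> Pi\<^sub>E UNIV V \<subseteq> U"
      by (intro exI[of _ ?V]) simp
  qed
qed

lemma openin_cantor_cyl: "openin cantor_top {y. \<forall>i<n. y i = x i}"
  unfolding openin_cantor_iff by (auto intro!: exI[of _ n])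

lemma openin_cantor_coord: "openin cantor_top {x. x i = b}"
  unfolding openin_cantor_iff by (auto intro!: exI[of _ "Suc i"])

lemma metrizable_cantor: "metrizable_space cantor_top"
  unfolding cantor_top_def by (simp add: metrizable_space_product_topology)

lemma sigma0_unfold:
  fixes \<xi> :: "'o::wellorder"
  shows "sigma0 X \<xi> = (if is_zero \<xi> then {U. openin X U}
     else {\<Union>(range A) | A. \<forall>n::nat. \<exists>\<eta><\<xi>. A n \<in> pi0 X \<eta>})"
proof -
  have "sigma0 X \<xi> = sigma_step X (cut (sigma0 X) {(x, y). x < y} \<xi>) \<xi>"
    unfolding sigma0_def by (rule wfrec[OF wf])
  moreover have "(A n \<in> (\<lambda>B. topspace X - B) ` cut (sigma0 X) {(x, y). x < y} \<xi> \<eta>) = (A n \<in> pi0 X \<eta>)"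
    if "\<eta> < \<xi>" for \<eta> and A :: "nat \<Rightarrow> 'a set" and n
    using that by (simp add: cut_def pi0_def)
  ultimately show ?thesis
    unfolding sigma_step_def by (auto cong: conj_cong)
qed

lemma sigma0_zero: "is_zero \<xi> \<Longrightarrow> A \<in> sigma0 X \<xi> \<longleftrightarrow> openin X A"
  by (simp add: sigma0_unfold)

lemma sigma0_nonzero:
  "\<not> is_zero \<xi> \<Longrightarrow> A \<in> sigma0 X \<xi> \<longleftrightarrow> (\<exists>B. A = \<Union>(range B) \<and> (\<forall>n::nat. \<exists>\<eta><\<xi>. B n \<in> pi0 X \<eta>))"
  by (subst sigma0_unfold) simp

lemma sigma0_subset: "A \<in> sigma0 X (\<xi>::'o::wellorder) \<Longrightarrow> A \<subseteq> topspace X"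
proof (cases "is_zero \<xi>")
  case True
  assume "A \<in> sigma0 X \<xi>" with True show ?thesis by (simp add: sigma0_zero openin_subset)
next
  case False
  assume "A \<in> sigma0 X \<xi>"
  with False show ?thesis by (force simp: sigma0_nonzero pi0_def)
qed

lemma pi0_iff: "A \<in> pi0 X \<xi> \<longleftrightarrow> A \<subseteq> topspace X \<and> topspace X - A \<in> sigma0 X \<xi>"
proof
  assume "A \<in> pi0 X \<xi>"
  then obtain B where "B \<in> sigma0 X \<xi>" "A = topspace X - B" by (auto simp: pi0_def)
  then show "A \<subseteq> topspace X \<and> topspace X - A \<in> sigma0 X \<xi>"
    using sigma0_subset[of B X \<xi>] by (simp add: double_diff)
next
  assume "A \<subseteq> topspace X \<and> topspace X - A \<in> sigma0 X \<xi>"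
  then show "A \<in> pi0 X \<xi>"
    unfolding pi0_def by (intro image_eqI[of _ _ "topspace X - A"]) auto
qed

lemma pi0_zero: "is_zero \<xi> \<Longrightarrow> A \<in> pi0 X \<xi> \<longleftrightarrow> closedin X A"
  by (simp add: pi0_iff sigma0_zero closedin_def)

lemma ex_zero: "\<exists>z::'o::wellorder. is_zero z"
proof -
  have "(LEAST x::'o. True) \<le> y" for y by (rule Least_le) simp
  then show ?thesis unfolding is_zero_def by (metis not_less)
qed

lemma is_zero_le: "is_zero (z::'o::wellorder) \<Longrightarrow> z \<le> x"
  by (auto simp: is_zero_def not_less)

text \<open>For nonzero \<open>\<theta>\<close> the countable union witnessing \<open>A\<close>
  serves again at level \<open>\<xi>\<close>. Only \<open>\<theta>\<close> zero needs metrizability,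
  which makes an open set a countable union of closed sets.\<close>

lemma sigma0_mono:
  fixes \<theta> \<xi> :: "'o::wellorder"
  assumes X: "metrizable_space X" and "\<theta> \<le> \<xi>" and A: "A \<in> sigma0 X \<theta>"
  shows "A \<in> sigma0 X \<xi>"
proof (cases "\<theta> = \<xi>")
  case False
  with \<open>\<theta> \<le> \<xi>\<close> have lt: "\<theta> < \<xi>" by simp
  then have nz: "\<not> is_zero \<xi>" by (auto simp: is_zero_def)
  show ?thesis
  proof (cases "is_zero \<theta>")
    case True
    then have "openin X A" using A by (simp add: sigma0_zero)
    then obtain C :: "nat \<Rightarrow> _" where "\<forall>n. closedin X (C n)" "\<Union> (range C) = A"
      using open_imp_fsigma_in[OF X] unfolding fsigma_in_ascending by blast
    then have "A = \<Union>(range C)" "\<forall>n. C n \<in> pi0 X \<theta>" using pi0_zero[OF True] by auto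
    then show ?thesis unfolding sigma0_nonzero[OF nz] using lt by blast
  next
    case False
    with A obtain B where B: "A = \<Union>(range B)" "\<forall>n::nat. \<exists>\<eta><\<theta>. B n \<in> pi0 X \<eta>"
      by (auto simp: sigma0_nonzero)
    have "\<forall>n::nat. \<exists>\<eta><\<xi>. B n \<in> pi0 X \<eta>" using B(2) less_trans[OF _ lt] by blast
    with B(1) show ?thesis unfolding sigma0_nonzero[OF nz] by blast
  qed
qed (use A in simp)

lemma pi0_mono:
  "metrizable_space X \<Longrightarrow> (\<theta>::'o::wellorder) \<le> \<xi> \<Longrightarrow> A \<in> pi0 X \<theta> \<Longrightarrow> A \<in> pi0 X \<xi>"
  unfolding pi0_iff using sigma0_mono by blast

lemma pi0_sigma0: "(\<theta>::'o::wellorder) < \<xi> \<Longrightarrow> A \<in> pi0 X \<theta> \<Longrightarrow> A \<in> sigma0 X \<xi>"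
  by (subst sigma0_nonzero) (auto simp: is_zero_def intro!: exI[of _ "\<lambda>_. A"])

lemma sigma0_UN:
  fixes \<xi> :: "'o::wellorder"
  assumes "\<And>n::nat. A n \<in> sigma0 X \<xi>"
  shows "(\<Union>n. A n) \<in> sigma0 X \<xi>"
proof (cases "is_zero \<xi>")
  case True
  with assms show ?thesis by (auto simp: sigma0_zero)
next
  case False
  have "\<forall>n. \<exists>B. A n = \<Union>(range B) \<and> (\<forall>m::nat. \<exists>\<eta><\<xi>. B m \<in> pi0 X \<eta>)"
    using assms by (simp add: sigma0_nonzero[OF False])
  from choice[OF this] obtain B where
    "\<forall>n. A n = \<Union>(range (B n)) \<and> (\<forall>m::nat. \<exists>\<eta><\<xi>. B n m \<in> pi0 X \<eta>)" ..
  then have B: "A n = \<Union>(range (B n))" "\<exists>\<eta><\<xi>. B n m \<in> pi0 X \<eta>" for n m :: nat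
    by simp_all
  have "(\<Union>n. A n) = (\<Union>k. B (fst (prod_decode k)) (snd (prod_decode k)))"
  proof
    show "(\<Union>n. A n) \<subseteq> (\<Union>k. B (fst (prod_decode k)) (snd (prod_decode k)))"
    proof
      fix x assume "x \<in> (\<Union>n. A n)"
      then obtain n m where "x \<in> B n m" using B(1) by auto
      then show "x \<in> (\<Union>k. B (fst (prod_decode k)) (snd (prod_decode k)))"
        by (intro UN_I[of "prod_encode (n, m)"]) auto
    qed
  qed (use B(1) in auto)
  with B(2) show ?thesis unfolding sigma0_nonzero[OF False]
    by (intro exI[of _ "\<lambda>k. B (fst (prod_decode k)) (snd (prod_decode k))"]) simp
qed

lemma sigma0_Un:
  assumes "A \<in> sigma0 X (\<xi>::'o::wellorder)" "B \<in> sigma0 X \<xi>"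
  shows "A \<union> B \<in> sigma0 X \<xi>"
proof -
  have "A \<union> B = (\<Union>n::nat. if n = 0 then A else B)" by (auto split: if_splits)
  also have "\<dots> \<in> sigma0 X \<xi>"
    by (rule sigma0_UN) (use assms in auto)
  finally show ?thesis .
qed

lemma sigma0_preimage:
  fixes \<xi> :: "'o::wellorder"
  assumes f: "continuous_map X Y f"
  shows "A \<in> sigma0 Y \<xi> \<Longrightarrow> {x \<in> topspace X. f x \<in> A} \<in> sigma0 X \<xi>"
proof (induction \<xi> arbitrary: A rule: less_induct)
  case (less \<xi>)
  show ?case
  proof (cases "is_zero \<xi>")
    case True
    with less.prems f show ?thesis by (simp add: sigma0_zero openin_continuous_map_preimage)
  next
    case False
    with less.prems obtain B where B: "A = \<Union>(range B)" "\<forall>n::nat. \<exists>\<eta><\<xi>. B n \<in> pi0 Y \<eta>"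
      by (auto simp: sigma0_nonzero)
    have "\<exists>\<eta><\<xi>. {x \<in> topspace X. f x \<in> B n} \<in> pi0 X \<eta>" for n
    proof -
      obtain \<eta> where \<eta>: "\<eta> < \<xi>" "topspace Y - B n \<in> sigma0 Y \<eta>" using B(2) by (meson pi0_iff)
      have "topspace X - {x \<in> topspace X. f x \<in> B n} = {x \<in> topspace X. f x \<in> topspace Y - B n}"
        using continuous_map_funspace[OF f] by auto
      then have "{x \<in> topspace X. f x \<in> B n} \<in> pi0 X \<eta>"
        using less.IH[OF \<eta>] by (simp add: pi0_iff)
      with \<eta>(1) show ?thesis by blast
    qed
    then show ?thesis unfolding sigma0_nonzero[OF False] B(1)
      by (intro exI[of _ "\<lambda>n. {x \<in> topspace X. f x \<in> B n}"]) auto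
  qed
qed

section \<open>The maps rho and order-isomorphic intervals\<close>

text \<open>\<open>Mseq F x k\<close> is what remains of stage \<open>k\<close> of a limit construction once its \<open>k\<close> settled bits are
  dropped.\<close>

primrec Mseq :: "(nat \<Rightarrow> (nat \<Rightarrow> bool) \<Rightarrow> nat \<Rightarrow> bool) \<Rightarrow> (nat \<Rightarrow> bool) \<Rightarrow> nat \<Rightarrow> nat \<Rightarrow> bool" where
  "Mseq F x 0 = x"
| "Mseq F x (Suc k) = shift (F k (Mseq F x k))"

lemma lim_stage_Mseq: "lim_stage F x k (j + k) = Mseq F x k j"
proof (induction k arbitrary: j)
  case (Suc k)
  have "(\<lambda>j. lim_stage F x k (j + k)) = Mseq F x k" using Suc by blast
  then show ?case by (simp add: shift_def)
qed simp

lemma lim_stage_diag: "lim_stage F x (Suc k) k = F k (Mseq F x k) 0"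
proof -
  have "(\<lambda>j. lim_stage F x k (j + k)) = Mseq F x k" using lim_stage_Mseq by blast
  then show ?thesis by simp
qed

lemma rho_unfold: "rho seq \<xi> = rho_step seq (cut (rho seq) {(x, y). x < y} \<xi>) \<xi>"
  unfolding rho_def by (rule wfrec[OF wf])

lemma rho_zero: "is_zero \<xi> \<Longrightarrow> rho seq \<xi> = id"
  by (subst rho_unfold) (simp add: rho_step_def)

lemma is_succ_nonzero: "is_succ \<xi> \<Longrightarrow> \<not> is_zero \<xi>"
  by (auto simp: is_succ_def is_zero_def)

lemma opred_max:
  assumes "is_succ (\<xi>::'o::wellorder)"
  shows "opred \<xi> < \<xi>" "\<And>\<zeta>. \<zeta> < \<xi> \<Longrightarrow> \<zeta> \<le> opred \<xi>"
proof -
  obtain \<eta> where \<eta>: "\<eta> < \<xi>" "\<forall>\<zeta><\<xi>. \<zeta> \<le> \<eta>" using assms by (auto simp: is_succ_def)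
  have "opred \<xi> = \<eta>" unfolding opred_def using \<eta> by (intro the_equality) (auto intro: antisym)
  with \<eta> show "opred \<xi> < \<xi>" "\<And>\<zeta>. \<zeta> < \<xi> \<Longrightarrow> \<zeta> \<le> opred \<xi>" by auto
qed

lemma rho_succ: "is_succ \<xi> \<Longrightarrow> rho seq \<xi> = rho0 \<circ> rho seq (opred \<xi>)"
  by (subst rho_unfold) (simp add: rho_step_def is_succ_nonzero cut_apply opred_max)

lemma rho_limit:
  assumes "is_limit \<xi>" and "\<And>k. seq \<xi> k < \<xi>"
  shows "rho seq \<xi> x k = rho seq (seq \<xi> k) (Mseq (\<lambda>k. rho seq (seq \<xi> k)) x k) 0"
proof -
  have "rho seq \<xi> x k = lim_stage (\<lambda>k. rho seq (seq \<xi> k)) x (Suc k) k"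
    using assms by (subst rho_unfold) (simp add: rho_step_def is_limit_def cut_apply del: lim_stage.simps)
  then show ?thesis by (simp only: lim_stage_diag)
qed

text \<open>\<open>interval_iso \<xi> a c\<close> says \<open>a + \<xi> = c\<close>; the index type need not be closed under ordinal addition.\<close>

definition interval_iso :: "'o::wellorder \<Rightarrow> 'o \<Rightarrow> 'o \<Rightarrow> bool" where
  "interval_iso \<xi> a c \<longleftrightarrow> a \<le> c \<and> (\<exists>g. g ` {..<\<xi>} = {a..<c} \<and> strict_mono_on {..<\<xi>} g)"

lemma interval_iso_zero: "is_zero z \<Longrightarrow> interval_iso \<xi> z \<xi>"
proof -
  assume "is_zero z"
  then have "{z..<\<xi>} = {..<\<xi>}" using is_zero_le by auto
  then show ?thesis unfolding interval_iso_def
    using is_zero_le[OF \<open>is_zero z\<close>] by (intro conjI exI[of _ id]) (auto simp: strict_mono_on_def)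
qed

lemma interval_iso_of_zero: "interval_iso \<xi> a c \<Longrightarrow> is_zero \<xi> \<Longrightarrow> c = a"
  unfolding interval_iso_def is_zero_def by force

lemma interval_iso_less: "interval_iso \<xi> a c \<Longrightarrow> \<not> is_zero \<xi> \<Longrightarrow> a < c"
  unfolding interval_iso_def is_zero_def by force

text \<open>The isomorphism sends \<open>opred \<xi>\<close> to the largest point \<open>d\<close>
  of the interval, and its restriction below \<open>opred \<xi>\<close> is onto the points from
  \<open>a\<close> up to \<open>d\<close>. So \<open>c\<close> is the successor of
  \<open>d\<close>.\<close>

lemma interval_iso_succ:
  fixes \<xi> a c :: "'o::wellorder"
  assumes "interval_iso \<xi> a c" "is_succ \<xi>"
  obtains d where "interval_iso (opred \<xi>) a d" "d < c" "\<And>\<zeta>. \<zeta> < c \<Longrightarrow> \<zeta> \<le> d"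
proof -
  obtain g where g: "g ` {..<\<xi>} = {a..<c}" "strict_mono_on {..<\<xi>} g" and "a \<le> c"
    using assms(1) by (auto simp: interval_iso_def)
  note p = opred_max[OF assms(2)]
  let ?d = "g (opred \<xi>)"
  have d: "a \<le> ?d" "?d < c" using g(1) p(1) by auto
  have max: "\<zeta> \<le> ?d" if "\<zeta> < c" for \<zeta>
  proof (cases "a \<le> \<zeta>")
    case True
    with that have "\<zeta> \<in> g ` {..<\<xi>}" using g(1) by auto
    then obtain \<eta> where "\<eta> < \<xi>" "\<zeta> = g \<eta>" by auto
    then show ?thesis using p g(2) by (metis lessThan_iff strict_mono_on_leD)
  qed (use d in auto)
  have "g ` {..<opred \<xi>} = {a..<?d}"
  proof
    show "g ` {..<opred \<xi>} \<subseteq> {a..<?d}"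
    proof
      fix y assume "y \<in> g ` {..<opred \<xi>}"
      then obtain \<eta> where \<eta>: "\<eta> < opred \<xi>" "y = g \<eta>" by auto
      then have "\<eta> < \<xi>" using p(1) by simp
      then have "y \<ge> a" using g(1) \<eta>(2) by auto
      moreover have "y < ?d" using g(2) \<eta> p(1) \<open>\<eta> < \<xi>\<close> by (auto simp: strict_mono_on_def)
      ultimately show "y \<in> {a..<?d}" by simp
    qed
    show "{a..<?d} \<subseteq> g ` {..<opred \<xi>}"
    proof
      fix y assume y: "y \<in> {a..<?d}"
      then have "y \<in> g ` {..<\<xi>}" using g(1) d by auto
      then obtain \<eta> where \<eta>: "\<eta> < \<xi>" "y = g \<eta>" by auto
      have "\<eta> \<noteq> opred \<xi>" using y \<eta>(2) by auto
      then have "\<eta> < opred \<xi>" using p(2)[OF \<eta>(1)] by simp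
      with \<eta>(2) show "y \<in> g ` {..<opred \<xi>}" by blast
    qed
  qed
  moreover have "strict_mono_on {..<opred \<xi>} g"
    by (rule monotone_on_subset[OF g(2)]) (use p(1) in auto)
  ultimately have "interval_iso (opred \<xi>) a ?d" using d by (auto simp: interval_iso_def)
  with d max that show ?thesis by blast
qed

text \<open>The sum decomposition of \<open>l\<close> cuts the interval into consecutive blocks, the
  \<open>k\<close>-th one isomorphic to \<open>f k\<close>. Their left ends \<open>A k\<close> are
  the levels that the successive stages of a limit construction start from, and they are cofinal in
  \<open>c\<close>.\<close>

lemma interval_iso_limit:
  fixes l a c :: "'o::wellorder"
  assumes iso: "interval_iso l a c" and nz: "\<And>k. \<not> is_zero (f k)" and sum: "osum_eq f l" and "\<not> is_zero l"
  obtains A where "A 0 = a" "\<And>k. A k < c" "\<And>k. interval_iso (f k) (A k) (A (Suc k))"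
    "\<And>y. y < c \<Longrightarrow> \<exists>k. y < A k"
proof -
  obtain z :: 'o where z: "is_zero z" using ex_zero by blast
  have zf: "z < f k" for k using nz[of k] is_zero_le[OF z] by (auto simp: is_zero_def intro: le_less_trans)
  obtain g where g: "g ` {..<l} = {a..<c}" "strict_mono_on {..<l} g" and "a \<le> c"
    using iso by (auto simp: interval_iso_def)
  obtain h where h: "bij_betw h {(k, \<eta>). \<eta> < f k} {..<l}"
    and hm: "\<forall>k \<eta> k' \<eta>'. \<eta> < f k \<longrightarrow> \<eta>' < f k' \<longrightarrow> (k < k' \<or> (k = k' \<and> \<eta> < \<eta>'))
         \<longrightarrow> h (k, \<eta>) < h (k', \<eta>')"
    using sum by (auto simp: osum_eq_def)
  define q where "q k \<eta> = g (h (k, \<eta>))" for k \<eta>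
  have hl: "h (k, \<eta>) < l" if "\<eta> < f k" for k \<eta>
    using h that by (auto simp: bij_betw_def)
  have qm: "q k \<eta> < q k' \<eta>'" if "\<eta> < f k" "\<eta>' < f k'" "k < k' \<or> (k = k' \<and> \<eta> < \<eta>')" for k \<eta> k' \<eta>'
    using hm that hl g(2) unfolding q_def strict_mono_on_def by auto
  have qr: "a \<le> q k \<eta>" "q k \<eta> < c" if "\<eta> < f k" for k \<eta>
    using hl[OF that] g(1) unfolding q_def by auto
  have qs: "\<exists>k \<eta>. \<eta> < f k \<and> y = q k \<eta>" if "a \<le> y" "y < c" for y
  proof -
    have "y \<in> g ` (h ` {(k, \<eta>). \<eta> < f k})"
      using that g(1) bij_betw_imp_surj_on[OF h] by auto
    then show ?thesis unfolding q_def by auto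
  qed
  \<comment> \<open>The first point of block \<open>k\<close>. It exists because no
    \<open>f k\<close> is zero.\<close>
  define A where "A k = q k z" for k
  have ac: "a < c" using interval_iso_less[OF iso assms(4)] .
  have "A 0 = a"
  proof -
    obtain k \<eta> where k: "\<eta> < f k" "a = q k \<eta>" using qs[of a] ac by auto
    have "(k, \<eta>) = (0, z)"
    proof (rule ccontr)
      assume "(k, \<eta>) \<noteq> (0, z)"
      then have "0 < k \<or> (0 = k \<and> z < \<eta>)" using is_zero_le[OF z, of \<eta>] by auto
      then have "q 0 z < a" using qm[OF zf k(1)] k(2) by simp
      then show False using qr(1)[OF zf, of 0] by simp
    qed
    then show ?thesis using k(2) by (simp add: A_def)
  qed
  moreover have Ac: "A k < c" for k unfolding A_def using qr(2)[OF zf] .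
  moreover have "interval_iso (f k) (A k) (A (Suc k))" for k
  proof -
    have AA: "A k \<le> A (Suc k)" unfolding A_def using qm[OF zf zf, of k "Suc k"] by simp
    have "q k ` {..<f k} = {A k..<A (Suc k)}"
    proof
      show "q k ` {..<f k} \<subseteq> {A k..<A (Suc k)}"
      proof
        fix y assume "y \<in> q k ` {..<f k}"
        then obtain \<eta> where \<eta>: "\<eta> < f k" "y = q k \<eta>" by auto
        have "A k \<le> y"
        proof (cases "\<eta> = z")
          case False
          then have "z < \<eta>" using is_zero_le[OF z, of \<eta>] by simp
          then show ?thesis unfolding A_def \<eta>(2) using qm[OF zf \<eta>(1)] by (simp add: less_imp_le)
        qed (simp add: A_def \<eta>)
        moreover have "y < A (Suc k)" unfolding A_def \<eta>(2) using qm[OF \<eta>(1) zf] by simp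
        ultimately show "y \<in> {A k..<A (Suc k)}" by simp
      qed
      show "{A k..<A (Suc k)} \<subseteq> q k ` {..<f k}"
      proof
        fix y assume y: "y \<in> {A k..<A (Suc k)}"
        have "a \<le> y" "y < c" using y qr(1)[OF zf, of k] Ac[of "Suc k"] unfolding A_def by auto
        then obtain k' \<eta> where k: "\<eta> < f k'" "y = q k' \<eta>" using qs by blast
        have "\<not> k' < k" using qm[OF k(1) zf, of k] y k(2) by (auto simp: A_def)
        moreover have "\<not> k < k'"
        proof
          assume "k < k'"
          then have "Suc k < k' \<or> (Suc k = k' \<and> (z < \<eta> \<or> z = \<eta>))" using is_zero_le[OF z, of \<eta>] by auto
          then have "A (Suc k) \<le> y" unfolding A_def k(2) using qm[OF zf k(1), of "Suc k"]
            by (auto simp: less_imp_le)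
          with y show False by (meson atLeastLessThan_iff not_le)
        qed
        ultimately have "k' = k" by simp
        with k show "y \<in> q k ` {..<f k}" by auto
      qed
    qed
    moreover have "strict_mono_on {..<f k} (q k)" using qm by (auto simp: strict_mono_on_def)
    ultimately show ?thesis using AA by (auto simp: interval_iso_def)
  qed
  moreover have "\<exists>k. y < A k" if "y < c" for y
  proof (cases "a \<le> y")
    case True
    then obtain k \<eta> where k: "\<eta> < f k" "y = q k \<eta>" using qs[OF True \<open>y < c\<close>] by auto
    then have "y < A (Suc k)" unfolding A_def k(2) using qm[OF k(1) zf] by simp
    then show ?thesis by blast
  next
    case False
    then have "y < A 0" using \<open>A 0 = a\<close> by simp
    then show ?thesis by blast
  qed
  ultimately show ?thesis using that by blast
qed

section \<open>Measurability of rho and the upper bound on the complexity of the complement of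
  S\<close>

definition measurable_bits ::
    "'a topology \<Rightarrow> 'o::wellorder \<Rightarrow> ('a \<Rightarrow> nat \<Rightarrow> bool) \<Rightarrow> bool" where
  "measurable_bits X a F \<longleftrightarrow>
     (\<forall>i. {x \<in> topspace X. F x i} \<in> sigma0 X a \<and> {x \<in> topspace X. \<not> F x i} \<in> sigma0 X a)"

lemma measurable_bits_mono:
  "metrizable_space X \<Longrightarrow> a \<le> c \<Longrightarrow> measurable_bits X a F \<Longrightarrow> measurable_bits X c F"
  unfolding measurable_bits_def using sigma0_mono by blast

text \<open>A bit of \<open>rho0\<close> is 0 exactly when some bit in its column is 1, which is a
  countable union at level \<open>d\<close>. The complement is a Pi set of level \<open>d\<close>,
  so both are Sigma sets of any larger level.\<close>

lemma measurable_bits_rho0: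
  assumes X: "metrizable_space X" and "d < c" and F: "measurable_bits X d F"
  shows "measurable_bits X c (\<lambda>x. rho0 (F x))"
  unfolding measurable_bits_def
proof
  fix i
  let ?U = "\<Union>j. {x \<in> topspace X. F x (pair i j)}"
  have U: "?U \<in> sigma0 X d"
    by (rule sigma0_UN) (use F in \<open>simp add: measurable_bits_def\<close>)
  have "{x \<in> topspace X. \<not> rho0 (F x) i} = ?U"
    by (auto simp: rho0_def)
  moreover have "?U \<in> sigma0 X c" using sigma0_mono[OF X _ U] \<open>d < c\<close> by simp
  moreover have "{x \<in> topspace X. rho0 (F x) i} = topspace X - ?U"
    by (auto simp: rho0_def)
  moreover have "topspace X - ?U \<in> pi0 X d" using U by (simp add: pi0_def)
  ultimately show "{x \<in> topspace X. rho0 (F x) i} \<in> sigma0 X c \<and>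
      {x \<in> topspace X. \<not> rho0 (F x) i} \<in> sigma0 X c"
    using pi0_sigma0[OF \<open>d < c\<close>] by simp
qed

text \<open>The input \<open>F\<close> of arbitrary level \<open>a\<close> is what the limit case
  requires: the \<open>k\<close>-th map there is applied to the outcome of the earlier stages, of
  level \<open>A k\<close>. The levels then add up along the interval from \<open>a\<close> to
  \<open>c\<close>.\<close>

lemma measurable_bits_rho:
  fixes seq :: "'o::wellorder \<Rightarrow> nat \<Rightarrow> 'o"
  assumes good: "good_seq seq \<xi>\<^sub>0" and X: "metrizable_space X"
  shows "\<xi> \<le> \<xi>\<^sub>0 \<Longrightarrow> interval_iso \<xi> a c \<Longrightarrow> measurable_bits X a F
    \<Longrightarrow> measurable_bits X c (\<lambda>x. rho seq \<xi> (F x))"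
proof (induction \<xi> arbitrary: a c F rule: less_induct)
  case (less \<xi>)
  consider "is_zero \<xi>" | "is_succ \<xi>" | "is_limit \<xi>" by (auto simp: is_limit_def)
  then show ?case
  proof cases
    case 1
    with less.prems interval_iso_of_zero[OF less.prems(2)] show ?thesis by (simp add: rho_zero)
  next
    case 2
    obtain d where d: "interval_iso (opred \<xi>) a d" "d < c"
      using interval_iso_succ[OF less.prems(2) 2] by metis
    have "measurable_bits X d (\<lambda>x. rho seq (opred \<xi>) (F x))"
      using less.IH[OF opred_max(1)[OF 2] _ d(1) less.prems(3)] opred_max(1)[OF 2] less.prems(1) by simp
    from measurable_bits_rho0[OF X d(2) this] show ?thesis by (simp add: rho_succ[OF 2])
  next
    case 3
    have sq: "\<And>k. \<not> is_zero (seq \<xi> k)" "\<And>k. seq \<xi> k < \<xi>" "osum_eq (seq \<xi>) \<xi>"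
      using good less.prems(1) 3 by (auto simp: good_seq_def)
    have le: "seq \<xi> k \<le> \<xi>\<^sub>0" for k using sq(2)[of k] less.prems(1) by simp
    have nz: "\<not> is_zero \<xi>" using 3 by (simp add: is_limit_def)
    obtain A where A: "A 0 = a" "\<And>k. A k < c" "\<And>k. interval_iso (seq \<xi> k) (A k) (A (Suc k))"
      using interval_iso_limit[OF less.prems(2) sq(1,3) nz] by metis
    define M where "M = (\<lambda>x. Mseq (\<lambda>k. rho seq (seq \<xi> k)) (F x))"
    have stage: "measurable_bits X (A (Suc k)) (\<lambda>x. rho seq (seq \<xi> k) (M x k))"
      if "measurable_bits X (A k) (\<lambda>x. M x k)" for k
      using less.IH[OF sq(2) le A(3) that] .
    have "measurable_bits X (A k) (\<lambda>x. M x k)" for k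
    proof (induction k)
      case 0
      then show ?case using less.prems(3) by (simp add: A(1) M_def)
    next
      case (Suc k)
      have "M x (Suc k) = shift (rho seq (seq \<xi> k) (M x k))" for x by (simp add: M_def)
      with stage[OF Suc] show ?case by (simp add: measurable_bits_def shift_def)
    qed
    \<comment> \<open>Stage \<open>k\<close> ends at level \<open>A (Suc k)\<close>, which is still
      below \<open>c\<close>.\<close>
    then have "measurable_bits X c (\<lambda>x. rho seq (seq \<xi> k) (M x k))" for k
      using measurable_bits_mono[OF X _ stage] A(2) by (simp add: less_imp_le)
    moreover have "rho seq \<xi> (F x) k = rho seq (seq \<xi> k) (M x k) 0" for x k
      unfolding M_def by (rule rho_limit[where seq = seq, OF 3 sq(2)])
    ultimately show ?thesis unfolding measurable_bits_def by simp
  qed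
qed

lemma body_closed: "closedin (prod_topology cantor_top cantor_top) (body T)"
proof -
  have "openin (prod_topology cantor_top cantor_top) (- body T)"
    unfolding openin_prod_topology_alt
  proof (intro allI impI)
    fix \<alpha> \<beta> assume "(\<alpha>, \<beta>) \<in> - body T"
    then obtain n where n: "(map \<alpha> [0..<n], map \<beta> [0..<n]) \<notin> T" by (auto simp: body_def)
    have "{y. \<forall>i<n. y i = \<alpha> i} \<times> {y. \<forall>i<n. y i = \<beta> i} \<subseteq> - body T"
    proof clarify
      fix \<gamma> \<delta> assume "\<forall>i<n. \<gamma> i = \<alpha> i" "\<forall>i<n. \<delta> i = \<beta> i" and "(\<gamma>, \<delta>) \<in> body T"
      then have "(map \<gamma> [0..<n], map \<delta> [0..<n]) \<in> T" unfolding body_def by blast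
      moreover have "map \<gamma> [0..<n] = map \<alpha> [0..<n]" "map \<delta> [0..<n] = map \<beta> [0..<n]"
        using \<open>\<forall>i<n. \<gamma> i = \<alpha> i\<close> \<open>\<forall>i<n. \<delta> i = \<beta> i\<close> by simp_all
      ultimately show False using n by simp
    qed
    then show "\<exists>U V. openin cantor_top U \<and> openin cantor_top V \<and> \<alpha> \<in> U \<and> \<beta> \<in> V \<and> U \<times> V \<subseteq> - body T"
      using openin_cantor_cyl[of n \<alpha>] openin_cantor_cyl[of n \<beta>]
      by (intro exI[of _ "{y. \<forall>i<n. y i = \<alpha> i}"] exI[of _ "{y. \<forall>i<n. y i = \<beta> i}"] conjI)
        (assumption | simp)+
  qed
  then show ?thesis by (simp add: closedin_def Compl_eq_Diff_UNIV)
qed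

lemma measurable_symdiff:
  assumes "is_zero z"
  shows "measurable_bits (prod_topology cantor_top cantor_top) z (\<lambda>x. shift (symdiff (fst x) (snd x)))"
proof -
  let ?X = "prod_topology cantor_top cantor_top"
  have R: "openin ?X ({x. x i = b} \<times> {x. x i = c})" for i b c
    by (simp add: openin_prod_Times_iff openin_cantor_coord)
  have 1: "{x \<in> topspace ?X. shift (symdiff (fst x) (snd x)) i} =
      ({x. x (i+1) = True} \<times> {x. x (i+1) = False}) \<union> ({x. x (i+1) = False} \<times> {x. x (i+1) = True})" for i
    by (auto simp: shift_def symdiff_def)
  have 2: "{x \<in> topspace ?X. \<not> shift (symdiff (fst x) (snd x)) i} =
      ({x. x (i+1) = True} \<times> {x. x (i+1) = True}) \<union> ({x. x (i+1) = False} \<times> {x. x (i+1) = False})" for i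
    by (auto simp: shift_def symdiff_def)
  show ?thesis
    unfolding measurable_bits_def sigma0_zero[OF assms] 1 2 by (intro allI conjI openin_Un R)
qed

text \<open>A pair lies outside this set iff it leaves the closed set
  \<open>body (test_tree E)\<close> or some bit of rho of its shifted difference is 1. Both are
  Sigma conditions of level \<open>\<xi>\<close>.\<close>

theorem body_diff_S_set_pi0:
  assumes good: "good_seq seq (\<xi>::'o::wellorder)"
  shows "body (test_tree E) - S_set seq E \<xi> \<in> pi0 (prod_topology cantor_top cantor_top) \<xi>"
proof -
  let ?X = "prod_topology cantor_top cantor_top"
  let ?F = "\<lambda>x. rho seq \<xi> (shift (symdiff (fst x) (snd x)))"
  obtain z :: 'o where z: "is_zero z" using ex_zero by blast
  have X: "metrizable_space ?X"
    by (simp add: metrizable_space_prod_topology metrizable_cantor)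
  have m: "measurable_bits ?X \<xi> ?F"
    using measurable_bits_rho[OF good X order_refl interval_iso_zero[OF z] measurable_symdiff[OF z]] .
  have "- body (test_tree E) \<in> sigma0 ?X z"
    using body_closed[of "test_tree E"] by (simp add: sigma0_zero[OF z] closedin_def Compl_eq_Diff_UNIV)
  then have b: "- body (test_tree E) \<in> sigma0 ?X \<xi>"
    using sigma0_mono[OF X is_zero_le[OF z]] by blast
  have u: "(\<Union>i. {x \<in> topspace ?X. ?F x i}) \<in> sigma0 ?X \<xi>"
    by (rule sigma0_UN) (use m in \<open>simp add: measurable_bits_def\<close>)
  have "topspace ?X - (body (test_tree E) - S_set seq E \<xi>) =
      - body (test_tree E) \<union> (\<Union>i. {x \<in> topspace ?X. ?F x i})"
    by (auto simp: S_set_def H_def fun_eq_iff)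
  then show ?thesis using sigma0_Un[OF b u] by (simp add: pi0_iff)
qed

section \<open>Coding Borel sets into the coordinates of rho\<close>

lemma pair_eq_prod_encode: "pair n p = prod_encode (p, n)"
proof -
  have "(\<Sum>k\<le>m. k) = triangle m" for m
    by (induction m) simp_all
  then show ?thesis by (simp add: pair_def prod_encode_def add.commute)
qed

lemma pair_eq_iff [simp]: "pair n p = pair n' p' \<longleftrightarrow> n = n' \<and> p = p'"
  by (auto simp: pair_eq_prod_encode)

lemma unpair0_pair [simp]: "unpair0 (pair n p) = n"
  unfolding unpair0_def by (rule the_equality) auto

lemma ex_pair: "\<exists>p. q = pair (unpair0 q) p"
proof -
  have "q = pair (snd (prod_decode q)) (fst (prod_decode q))"
    by (simp add: pair_eq_prod_encode)
  then show ?thesis by (metis unpair0_pair)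
qed

lemma infinite_fibres:
  assumes "infinite (R :: nat set)"
  obtains e :: "nat \<Rightarrow> nat" where "\<And>k. infinite {n \<in> R. e n = k}"
proof -
  have b: "bij_betw (to_nat_on R) R UNIV"
    using assms by (intro to_nat_on_infinite) auto
  define e where "e n = fst (prod_decode (to_nat_on R n))" for n
  have "infinite {n \<in> R. e n = k}" for k
  proof
    assume fin: "finite {n \<in> R. e n = k}"
    have "range (\<lambda>j. prod_encode (k, j)) \<subseteq> to_nat_on R ` {n \<in> R. e n = k}"
    proof
      fix m assume "m \<in> range (\<lambda>j. prod_encode (k, j))"
      then have m: "fst (prod_decode m) = k" by auto
      obtain n where "n \<in> R" "m = to_nat_on R n"
        using bij_betw_imp_surj_on[OF b] by (metis UNIV_I imageE)
      with m show "m \<in> to_nat_on R ` {n \<in> R. e n = k}" by (auto simp: e_def)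
    qed
    with fin have "finite (range (\<lambda>j. prod_encode (k, j)))" by (meson finite_imageI finite_subset)
    moreover have "inj (\<lambda>j. prod_encode (k, j))" by (auto simp: inj_def)
    ultimately show False using range_inj_infinite by blast
  qed
  with that show ?thesis by blast
qed

text \<open>Input \<open>i\<close> may influence no output bit other than \<open>\<pi> i\<close>.
  Distinct output bits are thus fed by disjoint sets of inputs and can be controlled
  independently.\<close>

definition local_map :: "((nat \<Rightarrow> bool) \<Rightarrow> nat \<Rightarrow> bool) \<Rightarrow> bool" where
  "local_map G \<longleftrightarrow> (\<exists>\<pi>::nat \<Rightarrow> nat. \<forall>n x y. (\<forall>i. \<pi> i = n \<longrightarrow> x i = y i) \<longrightarrow> G x n = G y n)"

lemma local_map_comp:
  assumes "local_map F" "local_map G"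
  shows "local_map (\<lambda>x. F (G x))"
proof -
  obtain p where p: "\<And>n x y. (\<forall>i. p i = n \<longrightarrow> x i = y i) \<Longrightarrow> F x n = F y n"
    using assms(1) unfolding local_map_def by metis
  obtain q where q: "\<And>n x y. (\<forall>i. q i = n \<longrightarrow> x i = y i) \<Longrightarrow> G x n = G y n"
    using assms(2) unfolding local_map_def by metis
  have "F (G x) n = F (G y) n" if "\<forall>i. p (q i) = n \<longrightarrow> x i = y i" for n x y
  proof (rule p, intro allI impI)
    fix i assume "p i = n"
    then show "G x i = G y i" using that by (intro q) auto
  qed
  then show ?thesis unfolding local_map_def by (intro exI[of _ "\<lambda>i. p (q i)"]) blast
qed

lemma local_map_id: "local_map (\<lambda>x. x)"
  unfolding local_map_def by (rule exI[of _ "\<lambda>i. i"]) auto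

lemma local_map_shift: "local_map shift"
  unfolding local_map_def shift_def by (rule exI[of _ "\<lambda>i. i - 1"]) auto

lemma local_map_rho0: "local_map rho0"
  unfolding local_map_def rho0_def by (rule exI[of _ unpair0]) auto

lemma local_map_rho:
  fixes seq :: "'o::wellorder \<Rightarrow> nat \<Rightarrow> 'o"
  assumes good: "good_seq seq \<xi>\<^sub>0"
  shows "\<xi> \<le> \<xi>\<^sub>0 \<Longrightarrow> local_map (rho seq \<xi>)"
proof (induction \<xi> rule: less_induct)
  case (less \<xi>)
  consider "is_zero \<xi>" | "is_succ \<xi>" | "is_limit \<xi>" by (auto simp: is_limit_def)
  then show ?case
  proof cases
    case 1
    then show ?thesis using local_map_id by (simp add: rho_zero id_def)
  next
    case 2
    have "local_map (rho seq (opred \<xi>))"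
      using less.IH[OF opred_max(1)[OF 2]] opred_max(1)[OF 2] less.prems by simp
    from local_map_comp[OF local_map_rho0 this] show ?thesis by (simp add: rho_succ[OF 2] comp_def)
  next
    case 3
    have sq: "\<And>k. seq \<xi> k < \<xi>" using good less.prems 3 by (auto simp: good_seq_def)
    have "\<forall>k. local_map (rho seq (seq \<xi> k))"
      using less.IH[OF sq] sq less.prems by (meson less_imp_le order_trans)
    then have "\<forall>k. \<exists>\<pi>::nat \<Rightarrow> nat. \<forall>n x y. (\<forall>i. \<pi> i = n \<longrightarrow> x i = y i) \<longrightarrow>
        rho seq (seq \<xi> k) x n = rho seq (seq \<xi> k) y n"
      unfolding local_map_def .
    from choice[OF this] obtain p :: "nat \<Rightarrow> nat \<Rightarrow> nat" where
      "\<forall>k. \<forall>n x y. (\<forall>i. p k i = n \<longrightarrow> x i = y i) \<longrightarrow>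
        rho seq (seq \<xi> k) x n = rho seq (seq \<xi> k) y n" ..
    then have p: "rho seq (seq \<xi> k) x n = rho seq (seq \<xi> k) y n"
      if "\<And>i. p k i = n \<Longrightarrow> x i = y i" for k n x y using that by blast
    \<comment> \<open>\<open>q k i\<close> is the coordinate of the \<open>k\<close>-th stage which is fed by \<open>i\<close>; the input \<open>i\<close> is used up
      at the first stage \<open>k\<close> with \<open>p k (q k i) = 0\<close>.\<close>
    define q where "q k i = rec_nat i (\<lambda>k m. p k m - 1) k" for k i
    have q: "q 0 i = i" "q (Suc k) i = p k (q k i) - 1" for k i by (simp_all add: q_def)
    define M where "M = Mseq (\<lambda>k. rho seq (seq \<xi> k))"
    \<comment> \<open>The side condition discards inputs already used up: after
      \<open>p j (q j i) = 0\<close> the truncated subtraction makes the later values of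
      \<open>q\<close> meaningless.\<close>
    have M: "M x k m = M y k m"
      if "\<And>i. q k i = m \<Longrightarrow> (\<And>j. j < k \<Longrightarrow> p j (q j i) \<noteq> 0) \<Longrightarrow> x i = y i" for x y k m
      using that
    proof (induction k arbitrary: m)
      case 0
      then show ?case by (simp add: M_def q)
    next
      case (Suc k)
      have "rho seq (seq \<xi> k) (M x k) (m + 1) = rho seq (seq \<xi> k) (M y k) (m + 1)"
      proof (rule p)
        fix m' assume m': "p k m' = m + 1"
        show "M x k m' = M y k m'"
        proof (rule Suc.IH)
          fix i assume "q k i = m'" and "\<And>j. j < k \<Longrightarrow> p j (q j i) \<noteq> 0"
          then show "x i = y i" using m' by (intro Suc.prems) (auto simp: q less_Suc_eq)
        qed
      qed
      then show ?case by (simp add: M_def shift_def)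
    qed
    define \<pi> where "\<pi> i = (LEAST k. p k (q k i) = 0)" for i
    have "rho seq \<xi> x n = rho seq \<xi> y n" if xy: "\<forall>i. \<pi> i = n \<longrightarrow> x i = y i" for n x y
    proof -
      have "rho seq (seq \<xi> n) (M x n) 0 = rho seq (seq \<xi> n) (M y n) 0"
      proof (rule p)
        fix m assume m: "p n m = 0"
        show "M x n m = M y n m"
        proof (rule M)
          fix i assume i: "q n i = m" "\<And>j. j < n \<Longrightarrow> p j (q j i) \<noteq> 0"
          have "\<pi> i = n" unfolding \<pi>_def
          proof (rule Least_equality)
            show "p n (q n i) = 0" using m i by simp
            show "n \<le> k" if "p k (q k i) = 0" for k using i(2)[of k] that by (metis not_less)
          qed
          with xy show "x i = y i" by blast
        qed
      qed
      then show ?thesis unfolding M_def rho_limit[where seq = seq, OF 3 sq] .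
    qed
    then show ?thesis unfolding local_map_def by blast
  qed
qed

section \<open>Reductions of Borel sets to the bits of rho\<close>

text \<open>A family \<open>Q\<close> with \<open>determined i (Q i)\<close> for all \<open>i\<close> is a strategy for the second player in a Wadge
  game in which this player moves first.\<close>

definition determined :: "nat \<Rightarrow> (nat \<Rightarrow> bool) set \<Rightarrow> bool" where
  "determined n Q \<longleftrightarrow> (\<forall>x y. (\<forall>i<n. x i = y i) \<longrightarrow> (x \<in> Q \<longleftrightarrow> y \<in> Q))"

text \<open>A reduction of \<open>B\<close> to a single output bit of \<open>G\<close>, along a map
  whose bit \<open>i\<close> depends only on the first \<open>i\<close> bits of
  \<open>z\<close>.\<close>

definition coded :: "((nat \<Rightarrow> bool) \<Rightarrow> nat \<Rightarrow> bool) \<Rightarrow> nat \<Rightarrow> (nat \<Rightarrow> bool) set \<Rightarrow> bool" where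
  "coded G n B \<longleftrightarrow> (\<exists>Q. (\<forall>i. determined i (Q i)) \<and> (\<forall>z. G (\<lambda>i. z \<in> Q i) n \<longleftrightarrow> z \<in> B))"

text \<open>The set \<open>R\<close> of available output bits is an arbitrary infinite set, so that
  the property survives both operations building rho: \<open>rho0\<close> takes a column for
  \<open>R\<close>, and \<open>shift\<close> moves \<open>R\<close> by one.\<close>

definition coding :: "'o::wellorder \<Rightarrow> ((nat \<Rightarrow> bool) \<Rightarrow> nat \<Rightarrow> bool) \<Rightarrow> bool" where
  "coding d G \<longleftrightarrow> local_map G \<and>
     (\<forall>P\<in>pi0 cantor_top d. \<forall>R. infinite R \<longrightarrow>
        (\<exists>B. (\<forall>n\<in>R. coded G n (B n)) \<and> P = - (\<Union>n\<in>R. B n)))"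

lemma codingE:
  assumes "coding d G" "P \<in> pi0 cantor_top d" "infinite R"
  obtains B where "\<And>n. n \<in> R \<Longrightarrow> coded G n (B n)" "P = - (\<Union>n\<in>R. B n)"
proof -
  from assms(1)[unfolded coding_def, THEN conjunct2, rule_format, OF assms(2,3)]
  obtain B where "(\<forall>n\<in>R. coded G n (B n)) \<and> P = - (\<Union>n\<in>R. B n)" ..
  then have "\<And>n. n \<in> R \<Longrightarrow> coded G n (B n)" "P = - (\<Union>n\<in>R. B n)" by blast+
  then show thesis by (rule that)
qed

text \<open>Since input \<open>i\<close> matters only for output \<open>\<pi> i\<close>, the merged
  family can follow at \<open>i\<close> the strategy chosen for that output. Where
  \<open>\<pi> i\<close> is outside \<open>R\<close>, the empty set is a default.\<close>

lemma coded_glue: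
  assumes "local_map G" and B: "\<And>n. n \<in> R \<Longrightarrow> coded G n (B n)"
  obtains Q where "\<And>i. determined i (Q i)" "\<And>n z. n \<in> R \<Longrightarrow> G (\<lambda>i. z \<in> Q i) n \<longleftrightarrow> z \<in> B n"
proof -
  obtain \<pi> where \<pi>: "\<And>n x y. (\<forall>i. \<pi> i = n \<longrightarrow> x i = y i) \<Longrightarrow> G x n = G y n"
    using assms(1) unfolding local_map_def by metis
  have "\<forall>n\<in>R. \<exists>Q. (\<forall>i. determined i (Q i)) \<and> (\<forall>z. G (\<lambda>i. z \<in> Q i) n \<longleftrightarrow> z \<in> B n)"
    using B by (simp add: coded_def)
  from bchoice[OF this] obtain S where
    S: "\<forall>n\<in>R. (\<forall>i. determined i (S n i)) \<and> (\<forall>z. G (\<lambda>i. z \<in> S n i) n \<longleftrightarrow> z \<in> B n)" ..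
  define Q where "Q i = (if \<pi> i \<in> R then S (\<pi> i) i else {})" for i
  have "determined i (Q i)" for i using S by (auto simp: Q_def determined_def)
  moreover have "G (\<lambda>i. z \<in> Q i) n \<longleftrightarrow> z \<in> B n" if "n \<in> R" for n z
  proof -
    have "G (\<lambda>i. z \<in> Q i) n = G (\<lambda>i. z \<in> S n i) n"
      by (rule \<pi>) (use that in \<open>auto simp: Q_def\<close>)
    with S that show ?thesis by auto
  qed
  ultimately show ?thesis using that by blast
qed

text \<open>The points whose first \<open>n\<close> bits already exclude a closed \<open>P\<close>
  form a set \<open>B n\<close> readable at coordinate \<open>n\<close>. These sets increase with
  \<open>n\<close>, so any infinite \<open>R\<close> exhausts the complement of
  \<open>P\<close>.\<close>

lemma coding_id:
  assumes "is_zero z"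
  shows "coding z (\<lambda>x. x)"
  unfolding coding_def
proof (intro conjI ballI allI impI local_map_id)
  fix P and R :: "nat set"
  assume "P \<in> pi0 cantor_top z" and R: "infinite R"
  then have "openin cantor_top (- P)"
    using assms by (simp add: pi0_zero closedin_def Compl_eq_Diff_UNIV)
  then have op: "\<And>x. x \<notin> P \<Longrightarrow> \<exists>n. \<forall>y. (\<forall>i<n. y i = x i) \<longrightarrow> y \<notin> P"
    unfolding openin_cantor_iff by auto
  define B where "B n = {x. \<forall>y. (\<forall>i<n. y i = x i) \<longrightarrow> y \<notin> P}" for n
  have "determined n (B n)" for n unfolding determined_def B_def by auto
  then have "coded (\<lambda>x. x) n (B n)" for n
    unfolding coded_def
    by (intro exI[of _ "\<lambda>i. if i = n then B n else {}"]) (auto simp: determined_def)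
  moreover have "P = - (\<Union>n\<in>R. B n)"
  proof -
    have "x \<in> (\<Union>n\<in>R. B n)" if "x \<notin> P" for x
    proof -
      obtain m where m: "\<forall>y. (\<forall>i<m. y i = x i) \<longrightarrow> y \<notin> P" using op \<open>x \<notin> P\<close> by blast
      obtain n where "n \<in> R" "m \<le> n" using R by (meson infinite_nat_iff_unbounded_le)
      with m have "x \<in> B n" by (auto simp: B_def)
      with \<open>n \<in> R\<close> show ?thesis by blast
    qed
    then show ?thesis unfolding B_def by blast
  qed
  ultimately show "\<exists>B. (\<forall>n\<in>R. coded (\<lambda>x. x) n (B n)) \<and> P = - (\<Union>n\<in>R. B n)" by blast
qed

lemma coding_shift:
  assumes "coding a G"
  shows "coding a (\<lambda>x. shift (G x))"
  unfolding coding_def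
proof (intro conjI ballI allI impI)
  show "local_map (\<lambda>x. shift (G x))"
    using assms local_map_comp[OF local_map_shift] by (auto simp: coding_def)
  fix P and R :: "nat set"
  assume P: "P \<in> pi0 cantor_top a" and "infinite R"
  have inf: "infinite (Suc ` R)" using \<open>infinite R\<close> by (simp add: finite_image_iff)
  obtain B where B: "\<And>n. n \<in> Suc ` R \<Longrightarrow> coded G n (B n)" "P = - (\<Union>n\<in>Suc ` R. B n)"
    by (rule codingE[OF assms P inf]) (rule that)
  show "\<exists>B. (\<forall>n\<in>R. coded (\<lambda>x. shift (G x)) n (B n)) \<and> P = - (\<Union>n\<in>R. B n)"
    by (rule exI[of _ "\<lambda>n. B (Suc n)"]) (use B in \<open>auto simp: coded_def shift_def\<close>)
qed

text \<open>Taking for \<open>R\<close> the column \<open>i\<close>, the pieces of the complement of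
  \<open>P\<close> are coded in the bits of that column. They are all 0 exactly on \<open>P\<close>,
  which is what bit \<open>i\<close> of \<open>rho0\<close> tests.\<close>

lemma coded_rho0:
  assumes G: "coding d G" and P: "P \<in> pi0 cantor_top d"
  shows "coded (\<lambda>x. rho0 (G x)) i P"
proof -
  have inf: "infinite (range (pair i))"
    by (rule range_inj_infinite) (simp add: inj_def)
  obtain B where B: "\<And>n. n \<in> range (pair i) \<Longrightarrow> coded G n (B n)"
    "P = - (\<Union>n\<in>range (pair i). B n)"
    by (rule codingE[OF G P inf]) (rule that)
  have "local_map G" using G by (simp add: coding_def)
  from coded_glue[OF this B(1)] obtain Q where Q: "\<And>i. determined i (Q i)"
    "\<And>n z. n \<in> range (pair i) \<Longrightarrow> G (\<lambda>i. z \<in> Q i) n \<longleftrightarrow> z \<in> B n" by blast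
  have "rho0 (G (\<lambda>i. z \<in> Q i)) i \<longleftrightarrow> z \<in> P" for z
    unfolding rho0_def B(2) using Q(2) by auto
  with Q(1) show ?thesis unfolding coded_def by blast
qed

text \<open>Each of the countably many sets whose union is the complement of \<open>P\<close> is repeated infinitely often,
  so that it also meets a coordinate with a large enough class.\<close>

lemma coding_nonzero:
  fixes A :: "nat \<Rightarrow> 'o::wellorder"
  assumes c: "\<not> is_zero c" and loc: "local_map G"
    and A: "\<And>y. y < c \<Longrightarrow> \<exists>m. \<forall>n\<ge>m. y \<le> A n"
    and G: "\<And>n B. B \<in> pi0 cantor_top (A n) \<Longrightarrow> coded G n B"
  shows "coding c G"
  unfolding coding_def
proof (intro conjI ballI allI impI loc)
  fix P and R :: "nat set"
  assume P: "P \<in> pi0 cantor_top c" and R: "infinite R"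
  then have "- P \<in> sigma0 cantor_top c" by (simp add: pi0_iff Compl_eq_Diff_UNIV)
  then obtain C where C: "- P = \<Union>(range C)" "\<forall>k::nat. \<exists>\<eta><c. C k \<in> pi0 cantor_top \<eta>"
    by (auto simp: sigma0_nonzero[OF c])
  obtain e :: "nat \<Rightarrow> nat" where e: "\<And>k. infinite {n \<in> R. e n = k}"
    using infinite_fibres[OF R] by metis
  have empty: "{} \<in> pi0 cantor_top y" for y :: 'o
  proof -
    obtain z :: 'o where "is_zero z" using ex_zero by blast
    then show ?thesis using pi0_mono[OF metrizable_cantor is_zero_le] by (metis closedin_empty pi0_zero)
  qed
  \<comment> \<open>A coordinate whose level \<open>A n\<close> is too small for the set
    \<open>C (e n)\<close> assigned to it codes the empty set instead.\<close>
  define B where "B n = (if C (e n) \<in> pi0 cantor_top (A n) then C (e n) else {})" for n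
  have "coded G n (B n)" for n by (rule G) (simp add: B_def empty)
  moreover have "P = - (\<Union>n\<in>R. B n)"
  proof -
    have "x \<in> (\<Union>n\<in>R. B n)" if "x \<in> C k" for x k
    proof -
      obtain \<eta> where \<eta>: "\<eta> < c" "C k \<in> pi0 cantor_top \<eta>" using C(2) by blast
      obtain m where m: "\<forall>n\<ge>m. \<eta> \<le> A n" using A[OF \<eta>(1)] by blast
      obtain n where n: "n \<ge> m" "n \<in> {n \<in> R. e n = k}"
        using e[of k] by (meson infinite_nat_iff_unbounded_le)
      then have "C k \<in> pi0 cantor_top (A n)" using m \<eta>(2) pi0_mono[OF metrizable_cantor] by blast
      with n that have "x \<in> B n" by (simp add: B_def)
      with n show ?thesis by blast
    qed
    then have "- P \<subseteq> (\<Union>n\<in>R. B n)" using C(1) by blast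
    moreover have "(\<Union>n\<in>R. B n) \<subseteq> - P" unfolding C(1) B_def by (auto split: if_splits)
    ultimately show ?thesis by blast
  qed
  ultimately show "\<exists>B. (\<forall>n\<in>R. coded G n (B n)) \<and> P = - (\<Union>n\<in>R. B n)" by blast
qed

text \<open>The second conjunct, a whole Pi set of the starting level in one single bit, feeds the
  limit case: bit \<open>k\<close> at a limit is one bit of stage \<open>k\<close>, which starts
  from level \<open>A k\<close>. In the successor and limit cases, the first conjunct follows from
  \<open>coding_nonzero\<close>.\<close>

lemma coding_rho:
  fixes seq :: "'o::wellorder \<Rightarrow> nat \<Rightarrow> 'o"
  assumes good: "good_seq seq \<xi>\<^sub>0"
  shows "\<xi> \<le> \<xi>\<^sub>0 \<Longrightarrow> interval_iso \<xi> a c \<Longrightarrow> coding a G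
    \<Longrightarrow> coding c (\<lambda>x. rho seq \<xi> (G x)) \<and>
      (\<not> is_zero \<xi> \<longrightarrow> (\<forall>n. \<forall>B\<in>pi0 cantor_top a. coded (\<lambda>x. rho seq \<xi> (G x)) n B))"
proof (induction \<xi> arbitrary: a c G rule: less_induct)
  case (less \<xi>)
  have loc: "local_map (\<lambda>x. rho seq \<xi> (G x))"
    using local_map_comp[OF local_map_rho[OF good less.prems(1)]] less.prems(3) by (simp add: coding_def)
  consider "is_zero \<xi>" | "is_succ \<xi>" | "is_limit \<xi>" by (auto simp: is_limit_def)
  then show ?case
  proof cases
    case 1
    with less.prems interval_iso_of_zero[OF less.prems(2)] show ?thesis by (simp add: rho_zero)
  next
    case 2
    obtain d where d: "interval_iso (opred \<xi>) a d" "d < c" "\<And>y. y < c \<Longrightarrow> y \<le> d"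
      using interval_iso_succ[OF less.prems(2) 2] by metis
    have "coding d (\<lambda>x. rho seq (opred \<xi>) (G x))"
      using less.IH[OF opred_max(1)[OF 2] _ d(1) less.prems(3)] opred_max(1)[OF 2] less.prems(1) by simp
    from coded_rho0[OF this]
    have cd: "coded (\<lambda>x. rho seq \<xi> (G x)) n B" if "B \<in> pi0 cantor_top d" for n B
      using that by (simp add: rho_succ[OF 2])
    have "a \<le> d" using d(1) by (simp add: interval_iso_def)
    then have "coded (\<lambda>x. rho seq \<xi> (G x)) n B" if "B \<in> pi0 cantor_top a" for n B
      using cd pi0_mono[OF metrizable_cantor _ that] by blast
    moreover have "coding c (\<lambda>x. rho seq \<xi> (G x))"
      using d(2,3) cd loc by (intro coding_nonzero[of c _ "\<lambda>_. d"]) (auto simp: is_zero_def)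
    ultimately show ?thesis by blast
  next
    case 3
    have sq: "\<And>k. \<not> is_zero (seq \<xi> k)" "\<And>k. seq \<xi> k < \<xi>" "osum_eq (seq \<xi>) \<xi>"
      using good less.prems(1) 3 by (auto simp: good_seq_def)
    have le: "seq \<xi> k \<le> \<xi>\<^sub>0" for k using sq(2)[of k] less.prems(1) by simp
    have nz: "\<not> is_zero \<xi>" using 3 by (simp add: is_limit_def)
    obtain A where A: "A 0 = a" "\<And>k. A k < c" "\<And>k. interval_iso (seq \<xi> k) (A k) (A (Suc k))"
      "\<And>y. y < c \<Longrightarrow> \<exists>k. y < A k"
      using interval_iso_limit[OF less.prems(2) sq(1,3) nz] by metis
    have mono: "A m \<le> A n" if "m \<le> n" for m n
      by (rule lift_Suc_mono_le[OF _ that]) (use A(3) in \<open>simp add: interval_iso_def\<close>)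
    define M where "M = (\<lambda>x. Mseq (\<lambda>k. rho seq (seq \<xi> k)) (G x))"
    have stage: "coding (A (Suc k)) (\<lambda>x. rho seq (seq \<xi> k) (M x k)) \<and>
        (\<forall>n. \<forall>B\<in>pi0 cantor_top (A k). coded (\<lambda>x. rho seq (seq \<xi> k) (M x k)) n B)"
      if "coding (A k) (\<lambda>x. M x k)" for k
      using less.IH[OF sq(2) le A(3) that] sq(1) by simp
    have "coding (A k) (\<lambda>x. M x k)" for k
    proof (induction k)
      case 0
      then show ?case using less.prems(3) by (simp add: A(1) M_def)
    next
      case (Suc k)
      then have "coding (A (Suc k)) (\<lambda>x. shift (rho seq (seq \<xi> k) (M x k)))"
        using stage coding_shift by blast
      then show ?case by (simp add: M_def)
    qed
    \<comment> \<open>Only bit 0 of stage \<open>k\<close> survives as an output, namely as bit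
      \<open>k\<close> at the limit. It codes every Pi set of level \<open>A k\<close>, and these
      levels are cofinal in \<open>c\<close>.\<close>
    with stage have "coded (\<lambda>x. rho seq (seq \<xi> k) (M x k)) 0 B" if "B \<in> pi0 cantor_top (A k)" for k B
      using that by blast
    moreover have "rho seq \<xi> (G x) k = rho seq (seq \<xi> k) (M x k) 0" for x k
      unfolding M_def by (rule rho_limit[where seq = seq, OF 3 sq(2)])
    ultimately have cd: "coded (\<lambda>x. rho seq \<xi> (G x)) k B" if "B \<in> pi0 cantor_top (A k)" for k B
      using that unfolding coded_def by simp
    have "coded (\<lambda>x. rho seq \<xi> (G x)) n B" if "B \<in> pi0 cantor_top a" for n B
      using cd pi0_mono[OF metrizable_cantor _ that, of "A n"] mono[of 0 n] A(1) by simp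
    moreover have "coding c (\<lambda>x. rho seq \<xi> (G x))"
    proof (rule coding_nonzero[of c _ A])
      show "\<not> is_zero c" using A(2) by (auto simp: is_zero_def)
      show "\<exists>m. \<forall>n\<ge>m. y \<le> A n" if "y < c" for y
        using A(4)[OF that] mono by (meson less_imp_le order_trans)
    qed (use loc cd in auto)
    ultimately show ?thesis by blast
  qed
qed

text \<open>Membership in \<open>Q i\<close> is decided by the first \<open>i\<close> bits, so
  \<open>z\<close> is built by recursion on \<open>i\<close>. The default values that
  \<open>cut\<close> puts from \<open>i\<close> on are invisible to \<open>Q i\<close>.\<close>

lemma determined_fixpoint:
  assumes "\<And>i. determined i (Q i)"
  shows "\<exists>z. \<forall>i. z i \<longleftrightarrow> z \<in> Q i"
proof -
  have "\<exists>z. \<forall>i. z i = (cut z {(x, y). x < y} i \<in> Q i)"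
    by (rule exI[of _ "wfrec {(x, y). x < y} (\<lambda>f i. f \<in> Q i)"]) (simp add: wfrec[OF wf, of "\<lambda>f i. f \<in> Q i"])
  then obtain z where z: "\<And>i. z i \<longleftrightarrow> cut z {(x, y). x < y} i \<in> Q i" by blast
  have "cut z {(x, y). x < y} i \<in> Q i \<longleftrightarrow> z \<in> Q i" for i
    using assms[of i] unfolding determined_def by (auto simp: cut_def)
  with z show ?thesis by blast
qed

theorem H_notin_sigma0:
  fixes \<xi> :: "'o::wellorder"
  assumes good: "good_seq seq \<xi>"
  shows "H seq \<xi> \<notin> sigma0 cantor_top \<xi>"
proof
  assume "H seq \<xi> \<in> sigma0 cantor_top \<xi>"
  then have P: "- H seq \<xi> \<in> pi0 cantor_top \<xi>" by (simp add: pi0_iff Compl_eq_Diff_UNIV double_diff)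
  obtain z :: 'o where z: "is_zero z" using ex_zero by blast
  have cod: "coding \<xi> (rho seq \<xi>)"
    using coding_rho[OF good order_refl interval_iso_zero[OF z] coding_id[OF z]] by blast
  obtain B where B: "\<And>n. n \<in> UNIV \<Longrightarrow> coded (rho seq \<xi>) n (B n)" "- H seq \<xi> = - (\<Union>n. B n)"
    by (rule codingE[OF cod P infinite_UNIV_nat]) (rule that)
  have "local_map (rho seq \<xi>)" using cod by (simp add: coding_def)
  from coded_glue[OF this B(1)] obtain Q where Q: "\<And>i. determined i (Q i)"
    "\<And>n z. n \<in> UNIV \<Longrightarrow> rho seq \<xi> (\<lambda>i. z \<in> Q i) n \<longleftrightarrow> z \<in> B n" by blast
  \<comment> \<open>The coded map returns \<open>x\<close> itself, so \<open>x\<close> lies in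
    \<open>H seq \<xi>\<close> iff it lies in no \<open>B n\<close>. But \<open>H seq \<xi>\<close>
    is the union of the \<open>B n\<close>.\<close>
  obtain x where x: "\<And>i. x i \<longleftrightarrow> x \<in> Q i" using determined_fixpoint[OF Q(1)] by blast
  then have "(\<lambda>i. x \<in> Q i) = x" by auto
  then have "x \<in> H seq \<xi> \<longleftrightarrow> (\<forall>n. x \<notin> B n)" using Q(2)[OF UNIV_I, of x] by (simp add: H_def fun_eq_iff)
  with B(2) show False by auto
qed

section \<open>Finer Polish topologies agree with the usual one on a comeager set\<close>

definition dense_open :: "(nat \<Rightarrow> bool) set \<Rightarrow> bool" where
  "dense_open U \<longleftrightarrow> openin cantor_top U \<and> (\<forall>V. openin cantor_top V \<longrightarrow> V \<noteq> {} \<longrightarrow> U \<inter> V \<noteq> {})"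

text \<open>Meagerness is phrased through dense open sets avoiding \<open>A\<close> in the limit,
  since a sequence of dense open sets is what the construction of branches meets one by one.\<close>

definition meager :: "(nat \<Rightarrow> bool) set \<Rightarrow> bool" where
  "meager A \<longleftrightarrow> (\<exists>D::nat \<Rightarrow> _. (\<forall>n. dense_open (D n)) \<and> A \<inter> (\<Inter>n. D n) = {})"

lemma dense_open_UNIV: "dense_open UNIV"
  using openin_topspace[of cantor_top] by (simp add: dense_open_def)

lemma meager_empty: "meager {}"
  unfolding meager_def by (rule exI[of _ "\<lambda>_. UNIV"]) (simp add: dense_open_UNIV)

lemma meager_subset: "meager B \<Longrightarrow> A \<subseteq> B \<Longrightarrow> meager A"
  unfolding meager_def by blast

lemma meager_Union_nat:
  assumes "\<And>n::nat. meager (A n)"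
  shows "meager (\<Union>n. A n)"
proof -
  have "\<forall>n. \<exists>D::nat \<Rightarrow> _. (\<forall>m. dense_open (D m)) \<and> A n \<inter> (\<Inter>m. D m) = {}"
    using assms by (simp add: meager_def)
  from choice[OF this] obtain D :: "nat \<Rightarrow> nat \<Rightarrow> _" where
    D: "\<forall>n. (\<forall>m. dense_open (D n m)) \<and> A n \<inter> (\<Inter>m. D n m) = {}" ..
  define D' where "D' k = D (fst (prod_decode k)) (snd (prod_decode k))" for k
  have "x \<in> D n m" if "x \<in> (\<Inter>k. D' k)" for x n m
    using INT_D[OF that, of "prod_encode (n, m)"] by (simp add: D'_def)
  then have "(\<Inter>k. D' k) \<subseteq> (\<Inter>m. D n m)" for n by blast
  then have "A n \<inter> (\<Inter>k. D' k) = {}" for n using D[rule_format, of n] by blast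
  then have "(\<Union>n. A n) \<inter> (\<Inter>k. D' k) = {}" by blast
  moreover have "dense_open (D' k)" for k using D by (simp add: D'_def)
  ultimately show ?thesis unfolding meager_def by (intro exI[of _ D']) simp
qed

lemma meager_UN:
  assumes "countable I" "\<And>i. i \<in> I \<Longrightarrow> meager (A i)"
  shows "meager (\<Union>i\<in>I. A i)"
proof (cases "I = {}")
  case False
  have "meager (\<Union>n. A (from_nat_into I n))"
    by (rule meager_Union_nat) (use assms(2) from_nat_into[OF False] in blast)
  then show ?thesis using range_from_nat_into[OF False assms(1)] by (metis image_image)
qed (simp add: meager_empty)

lemma meager_Un: "meager A \<Longrightarrow> meager B \<Longrightarrow> meager (A \<union> B)"
  using meager_UN[of "{A, B}" "\<lambda>X. X"] by auto

definition boundary :: "(nat \<Rightarrow> bool) set \<Rightarrow> (nat \<Rightarrow> bool) set" where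
  "boundary W = - (W \<union> cantor_top interior_of (- W))"

lemma meager_boundary:
  assumes "openin cantor_top W"
  shows "meager (boundary W)"
proof -
  have "dense_open (W \<union> cantor_top interior_of (- W))"
    unfolding dense_open_def
  proof (intro conjI allI impI)
    fix V :: "(nat \<Rightarrow> bool) set" assume V: "openin cantor_top V" "V \<noteq> {}"
    show "(W \<union> cantor_top interior_of (- W)) \<inter> V \<noteq> {}"
    proof (cases "W \<inter> V = {}")
      case True
      then have "V \<subseteq> cantor_top interior_of (- W)" using V(1) by (intro interior_of_maximal) auto
      with V(2) show ?thesis by blast
    qed blast
  qed (simp add: assms openin_Un)
  then show ?thesis unfolding meager_def boundary_def
    by (intro exI[of _ "\<lambda>_. W \<union> cantor_top interior_of (- W)"]) auto
qed

text \<open>A set \<open>A\<close> with the Baire property coincides with \<open>fat_part A\<close> up to a meager set.\<close>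

definition thin_part :: "(nat \<Rightarrow> bool) set \<Rightarrow> (nat \<Rightarrow> bool) set" where
  "thin_part A = \<Union>{V. openin cantor_top V \<and> meager (A \<inter> V)}"

definition fat_part :: "(nat \<Rightarrow> bool) set \<Rightarrow> (nat \<Rightarrow> bool) set" where
  "fat_part A = cantor_top interior_of (- thin_part A)"

lemma openin_thin_part: "openin cantor_top (thin_part A)"
  unfolding thin_part_def by blast

lemma openin_fat_part: "openin cantor_top (fat_part A)"
  by (simp add: fat_part_def)

lemma fat_part_subset: "fat_part A \<subseteq> - thin_part A"
  unfolding fat_part_def by (rule interior_of_subset)

lemma thin_partI: "openin cantor_top V \<Longrightarrow> meager (A \<inter> V) \<Longrightarrow> V \<subseteq> thin_part A"
  unfolding thin_part_def by blast

definition cyl :: "bool list \<Rightarrow> (nat \<Rightarrow> bool) set" where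
  "cyl l = {y. \<forall>i<length l. y i = l ! i}"

lemma cyl_append_subset: "cyl (l @ w) \<subseteq> cyl l"
proof
  fix x assume x: "x \<in> cyl (l @ w)"
  have "x i = l ! i" if "i < length l" for i
    using x that by (auto simp: cyl_def nth_append dest!: spec[of _ i])
  then show "x \<in> cyl l" by (simp add: cyl_def)
qed

lemma dense_open_cyl:
  assumes "dense_open U"
  shows "\<exists>w. cyl (l @ w) \<subseteq> U"
proof -
  have "openin cantor_top (cyl l)"
    using openin_cantor_cyl[of "length l" "(!) l"] by (simp add: cyl_def)
  moreover have "(\<lambda>i. l ! i) \<in> cyl l" by (simp add: cyl_def)
  ultimately obtain x where x: "x \<in> U" "x \<in> cyl l"
    using assms unfolding dense_open_def by blast
  then obtain n where n: "\<forall>y. (\<forall>i<n. y i = x i) \<longrightarrow> y \<in> U"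
    using assms unfolding dense_open_def openin_cantor_iff by blast
  have eq: "l @ map x [length l..<length l + n] = map x [0..<length l + n]"
    using x(2) by (intro nth_equalityI) (auto simp: cyl_def nth_append)
  have "cyl (map x [0..<length l + n]) \<subseteq> U"
    using n by (auto simp: cyl_def)
  then show ?thesis unfolding eq[symmetric] by blast
qed

lemma dense_open_Int:
  assumes "dense_open U" "dense_open V"
  shows "dense_open (U \<inter> V)"
  unfolding dense_open_def
proof (intro conjI allI impI)
  fix W :: "(nat \<Rightarrow> bool) set" assume W: "openin cantor_top W" "W \<noteq> {}"
  then have "openin cantor_top (U \<inter> W)" "U \<inter> W \<noteq> {}"
    using assms(1) by (auto simp: dense_open_def)
  then have "V \<inter> (U \<inter> W) \<noteq> {}" using assms(2) by (simp add: dense_open_def)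
  then show "U \<inter> V \<inter> W \<noteq> {}" by blast
qed (use assms in \<open>auto simp: dense_open_def\<close>)

text \<open>The union defining \<open>thin_part A\<close> may be uncountable, but it is covered by
  those cylinders on which \<open>A\<close> is meager, and there are only countably many
  cylinders.\<close>

lemma meager_Int_thin_part: "meager (A \<inter> thin_part A)"
proof -
  let ?I = "{l. meager (A \<inter> cyl l)}"
  have "meager (\<Union>l\<in>?I. A \<inter> cyl l)" by (rule meager_UN) auto
  moreover have "A \<inter> thin_part A \<subseteq> (\<Union>l\<in>?I. A \<inter> cyl l)"
  proof
    fix x assume "x \<in> A \<inter> thin_part A"
    then obtain V where V: "x \<in> A" "x \<in> V" "openin cantor_top V" "meager (A \<inter> V)"
      by (auto simp: thin_part_def)
    then obtain n where n: "\<forall>y. (\<forall>i<n. y i = x i) \<longrightarrow> y \<in> V"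
      unfolding openin_cantor_iff by blast
    let ?l = "map x [0..<n]"
    have "cyl ?l \<subseteq> V" using n by (auto simp: cyl_def)
    then have "meager (A \<inter> cyl ?l)" by (intro meager_subset[OF V(4)]) auto
    moreover have "x \<in> cyl ?l" by (simp add: cyl_def)
    ultimately show "x \<in> (\<Union>l\<in>?I. A \<inter> cyl l)" using V(1) by blast
  qed
  ultimately show ?thesis by (rule meager_subset)
qed

text \<open>On an open set missing all fat parts, each \<open>A i\<close> is covered by its meager
  trace on its thin part and by the boundary of that thin part. The union of the \<open>A i\<close>
  is then meager there, so this open set lies in the thin part of the union.\<close>

lemma fat_part_Union:
  assumes I: "countable I" and x: "x \<in> fat_part (\<Union>i\<in>I. A i)"
    and nb: "x \<notin> boundary (\<Union>i\<in>I. fat_part (A i))"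
  shows "x \<in> (\<Union>i\<in>I. fat_part (A i))"
proof (rule ccontr)
  let ?W = "\<Union>i\<in>I. fat_part (A i)" and ?V = "cantor_top interior_of (- (\<Union>i\<in>I. fat_part (A i)))"
  assume "x \<notin> ?W"
  with nb have "x \<in> ?V" unfolding boundary_def by blast
  have "?V \<subseteq> - ?W" by (rule interior_of_subset)
  have "meager (\<Union>i\<in>I. (A i \<inter> thin_part (A i)) \<union> boundary (thin_part (A i)))"
    by (intro meager_UN I meager_Un meager_Int_thin_part meager_boundary openin_thin_part)
  moreover have "(\<Union>i\<in>I. A i) \<inter> ?V \<subseteq> (\<Union>i\<in>I. (A i \<inter> thin_part (A i)) \<union> boundary (thin_part (A i)))"
    using \<open>?V \<subseteq> - ?W\<close> unfolding boundary_def fat_part_def by blast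
  ultimately have "meager ((\<Union>i\<in>I. A i) \<inter> ?V)" by (rule meager_subset)
  then have "x \<in> thin_part (\<Union>i\<in>I. A i)" using thin_partI[OF openin_interior_of] \<open>x \<in> ?V\<close> by blast
  with x fat_part_subset show False by blast
qed

text \<open>Outside a meager set \<open>Z\<close>, each ball of a countable base of
  \<open>\<sigma>\<close> has the same points as its fat part, which is open in the usual topology.
  A point of the ball lies in the fat part by the choice of \<open>Z\<close>. Conversely, a point of
  the fat part stays in the fat parts of a sequence of shrinking balls, and completeness forces
  these balls to converge to it.\<close>

theorem Polish_finer_agree:
  assumes pol: "Polish_space \<sigma>" and fin: "finer \<sigma> cantor_top"
  shows "\<exists>D::nat \<Rightarrow> (nat \<Rightarrow> bool) set. (\<forall>n. dense_open (D n)) \<and>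
    (\<forall>U. openin \<sigma> U \<longrightarrow> (\<exists>V. openin cantor_top V \<and> U \<inter> (\<Inter>n. D n) = V \<inter> (\<Inter>n. D n)))"
proof -
  obtain S d where S: "Metric_space S d" "Metric_space.mcomplete S d" "\<sigma> = Metric_space.mtopology S d"
    using pol by (auto simp: Polish_space_def completely_metrizable_space_def)
  interpret Metric_space S d by fact
  have "topspace \<sigma> = UNIV" using fin by (simp add: finer_def)
  then have SU [simp]: "x \<in> S" for x unfolding S(3) topspace_mtopology by simp
  obtain C where C: "countable C" "mtopology closure_of C = S"
    using pol unfolding Polish_space_def separable_space_def S(3) topspace_mtopology by blast
  define B where "B = (\<lambda>(c, m). mball c (1 / Suc m))"
  define B' where "B' = (\<lambda>(c, m). mcball c (1 / Suc m))"
  define I where "I = C \<times> (UNIV :: nat set)"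
  \<comment> \<open>Basic balls of radius at most \<open>1 / Suc n\<close> whose closed version is
    inside \<open>U\<close>. The closed version is what completeness needs.\<close>
  define ch where "ch n U = {p \<in> I. n \<le> snd p \<and> B' p \<subseteq> U}" for n U
  have BB': "B p \<subseteq> B' p" for p unfolding B_def B'_def by (auto split: prod.splits)
  have cI: "countable I" using C(1) by (simp add: I_def)
  have cch: "countable (ch n U)" for n U
    by (rule countable_subset[OF _ cI]) (auto simp: ch_def)
  have base: "\<exists>p\<in>ch n U. x \<in> B p" if U: "openin \<sigma> U" and "x \<in> U" for x n U
  proof -
    obtain r where r: "r > 0" "mball x r \<subseteq> U"
      using U \<open>x \<in> U\<close> unfolding S(3) openin_mtopology by blast
    obtain k :: nat where k: "2 / r < real k" using reals_Archimedean2 by blast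
    define m where "m = max n k"
    have "2 / r < real (Suc m)" using k by (simp add: m_def max_def)
    then have m: "2 / Suc m < r" using r(1) by (simp add: field_simps)
    have "x \<in> mtopology closure_of C" using C(2) by simp
    then obtain c where c: "c \<in> C" "c \<in> mball x (1 / Suc m)"
      unfolding metric_closure_of by (auto dest!: spec[of _ "1 / Suc m"])
    have "mcball c (1 / Suc m) \<subseteq> mball x r"
      by (rule mcball_subset_mball) (use c m in \<open>auto simp: commute field_simps\<close>)
    then have "(c, m) \<in> ch n U" using r(2) c(1) by (auto simp: ch_def I_def B'_def m_def)
    moreover have "x \<in> B (c, m)" using c(2) by (simp add: B_def commute)
    ultimately show ?thesis by blast
  qed
  have opB: "openin \<sigma> (B p)" for p unfolding S(3) B_def by (auto split: prod.splits)
  have un: "U = (\<Union>p\<in>ch n U. B p)" if "openin \<sigma> U" for n U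
    using base[OF that] BB' unfolding ch_def by blast
  \<comment> \<open>The first two terms make a point of \<open>B p\<close> lie in
    \<open>fat_part (B p)\<close>. The last one makes \<open>fat_part_Union\<close> applicable when
    a ball is written as a union of smaller ones.\<close>
  define Z where "Z = (\<Union>p\<in>I. (B p \<inter> thin_part (B p)) \<union> boundary (thin_part (B p)) \<union>
      (\<Union>n. boundary (\<Union>p'\<in>ch n (B p). fat_part (B p'))))"
  have "meager Z" unfolding Z_def
    by (intro meager_UN[OF cI] meager_Un meager_Int_thin_part meager_boundary meager_Union_nat
        openin_thin_part openin_Union) (auto simp: openin_fat_part)
  then obtain D :: "nat \<Rightarrow> _" where D: "\<And>n. dense_open (D n)" "Z \<inter> (\<Inter>n. D n) = {}"
    unfolding meager_def by blast
  have fat: "x \<in> fat_part (B p)" if "x \<notin> Z" "p \<in> I" "x \<in> B p" for x p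
  proof -
    have "x \<notin> thin_part (B p)" "x \<notin> boundary (thin_part (B p))" using that unfolding Z_def by blast+
    then show ?thesis unfolding boundary_def fat_part_def by blast
  qed
  have of_fat: "x \<in> B p" if x: "x \<notin> Z" and p: "p \<in> I" "x \<in> fat_part (B p)" for x p
  proof -
    have next_ball: "\<exists>p'. p' \<in> ch n (B p) \<and> x \<in> fat_part (B p')" if "p \<in> I" "x \<in> fat_part (B p)" for n p
    proof -
      have "x \<in> (\<Union>p'\<in>ch n (B p). fat_part (B p'))"
      proof (rule fat_part_Union[OF cch])
        show "x \<in> fat_part (\<Union>p'\<in>ch n (B p). B p')" using that un[OF opB, of p n] by simp
        show "x \<notin> boundary (\<Union>p'\<in>ch n (B p). fat_part (B p'))"
          using x that(1) unfolding Z_def by blast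
      qed
      then show ?thesis by blast
    qed
    obtain P where P: "P 0 = p" "\<And>n. P n \<in> I \<and> x \<in> fat_part (B (P n))" "\<And>n. P (Suc n) \<in> ch n (B (P n))"
    proof -
      have "\<exists>f. \<forall>n. (f n \<in> I \<and> x \<in> fat_part (B (f n)) \<and> (n = 0 \<longrightarrow> f n = p)) \<and> f (Suc n) \<in> ch n (B (f n))"
      proof (rule dependent_nat_choice)
        show "\<exists>q. q \<in> I \<and> x \<in> fat_part (B q) \<and> (0 = (0::nat) \<longrightarrow> q = p)" using p by blast
        fix q and n :: nat assume "q \<in> I \<and> x \<in> fat_part (B q) \<and> (n = 0 \<longrightarrow> q = p)"
        then obtain q' where "q' \<in> ch n (B q)" "x \<in> fat_part (B q')" using next_ball by blast
        moreover from this(1) have "q' \<in> I" by (simp add: ch_def)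
        ultimately show "\<exists>q'. (q' \<in> I \<and> x \<in> fat_part (B q') \<and> (Suc n = 0 \<longrightarrow> q' = p)) \<and> q' \<in> ch n (B q)"
          by blast
      qed
      then obtain f where "\<forall>n. (f n \<in> I \<and> x \<in> fat_part (B (f n)) \<and> (n = 0 \<longrightarrow> f n = p)) \<and> f (Suc n) \<in> ch n (B (f n))" ..
      then show ?thesis by (intro that[of f]) simp_all
    qed
    have dec: "B' (P (Suc n)) \<subseteq> B (P n)" and lvl: "n \<le> snd (P (Suc n))" for n
      using P(3)[of n] by (auto simp: ch_def)
    have ne: "B (P n) \<noteq> {}" for n
    proof
      assume "B (P n) = {}"
      then have "UNIV \<subseteq> thin_part (B (P n))"
        using openin_topspace[of cantor_top] by (intro thin_partI) (auto simp: meager_empty)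
      then show False using P(2)[of n] fat_part_subset by blast
    qed
    \<comment> \<open>The index starts at 1 because the radius of the initial ball
      \<open>P 0\<close> is not bounded by the construction.\<close>
    let ?C = "\<lambda>n. B' (P (Suc n))"
    have "\<Inter> (range ?C) \<noteq> {}"
    proof (rule S(2)[unfolded mcomplete_nest, rule_format], intro conjI allI impI)
      show "closedin mtopology (?C n)" for n unfolding B'_def by (auto split: prod.splits)
      show "?C n \<noteq> {}" for n using ne[of "Suc n"] BB' by blast
      show "decseq ?C" by (rule decseq_SucI) (use dec BB' in blast)
      fix \<epsilon> :: real assume "\<epsilon> > 0"
      obtain n :: nat where n: "1 / \<epsilon> < real n" using reals_Archimedean2 by blast
      obtain c m where cm: "P (Suc n) = (c, m)" by fastforce
      then have "n \<le> m" using lvl[of n] by simp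
      then have "1 / \<epsilon> < real (Suc m)" using n by simp
      then have "1 / Suc m \<le> \<epsilon>" using \<open>\<epsilon> > 0\<close> by (simp add: field_simps)
      then have "?C n \<subseteq> mcball c \<epsilon>" unfolding cm B'_def by (auto intro: mcball_subset_concentric)
      then show "\<exists>n a. ?C n \<subseteq> mcball a \<epsilon>" by blast
    qed
    then obtain y where y: "\<And>n. y \<in> ?C n" by blast
    \<comment> \<open>If \<open>y\<close> and \<open>x\<close> differ at \<open>i\<close>, then,
      \<open>\<sigma>\<close> being finer, small balls near \<open>y\<close> miss the usual
      neighbourhood of \<open>x\<close> given by coordinate \<open>i\<close>. That neighbourhood is
      thin for them, although \<open>x\<close> is in their fat part.\<close>
    have "y = x"
    proof (rule ccontr)
      assume "y \<noteq> x"
      then obtain i where i: "y i \<noteq> x i" by auto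
      have "openin \<sigma> {z. z i = y i}" using fin openin_cantor_coord by (auto simp: finer_def)
      then obtain r where r: "r > 0" "mball y r \<subseteq> {z. z i = y i}"
        unfolding S(3) openin_mtopology by blast
      obtain n :: nat where n: "2 / r < real n" using reals_Archimedean2 by blast
      obtain c m where cm: "P (Suc n) = (c, m)" by fastforce
      then have "n \<le> m" using lvl[of n] by simp
      then have "2 / r < real (Suc m)" using n by simp
      then have m: "2 / Suc m < r" using r(1) by (simp add: field_simps)
      have "B (P (Suc n)) \<subseteq> mball y r"
      proof
        fix z assume "z \<in> B (P (Suc n))"
        then have "d c z < 1 / Suc m" by (simp add: cm B_def)
        moreover have "d c y \<le> 1 / Suc m" using y[of n] by (simp add: cm B'_def)
        ultimately have "d y z < 2 / Suc m"
          using triangle[of y c z] commute[of y c] by simp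
        then show "z \<in> mball y r" using m by simp
      qed
      then have "B (P (Suc n)) \<inter> {z. z i = x i} = {}" using r(2) i by auto
      then have "{z. z i = x i} \<subseteq> thin_part (B (P (Suc n)))"
        using openin_cantor_coord[of i "x i"] by (intro thin_partI) (auto simp: meager_empty)
      then show False using P(2)[of "Suc n"] fat_part_subset by blast
    qed
    then show ?thesis using y[of 0] dec[of 0] P(1) by auto
  qed
  have "\<exists>V. openin cantor_top V \<and> U \<inter> (\<Inter>n. D n) = V \<inter> (\<Inter>n. D n)" if U: "openin \<sigma> U" for U
  proof (intro exI conjI)
    show "openin cantor_top (\<Union>p\<in>ch 0 U. fat_part (B p))"
      by (intro openin_Union) (auto simp: openin_fat_part)
    have "x \<in> U \<longleftrightarrow> x \<in> (\<Union>p\<in>ch 0 U. fat_part (B p))" if "x \<in> (\<Inter>n. D n)" for x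
    proof -
      have "x \<notin> Z" using that D(2) by blast
      then have "x \<in> B p \<longleftrightarrow> x \<in> fat_part (B p)" if "p \<in> ch 0 U" for p
        using fat of_fat that unfolding ch_def by blast
      then show ?thesis using un[OF U, of 0] by blast
    qed
    then show "U \<inter> (\<Inter>n. D n) = (\<Union>p\<in>ch 0 U. fat_part (B p)) \<inter> (\<Inter>n. D n)" by blast
  qed
  with D(1) show ?thesis by (intro exI[of _ D]) simp
qed

section \<open>Steering a branch of the tree generated by a test\<close>

lemma test_mem:
  assumes "is_test E"
  shows "(sq E q, tq E q) \<in> E" "length (sq E q) = q" "length (tq E q) = q"
proof -
  have "\<exists>!p. p \<in> E \<and> length (fst p) = q \<and> length (snd p) = q"
    using assms by (simp add: is_test_def)
  from theI'[OF this] show "(sq E q, tq E q) \<in> E" "length (sq E q) = q" "length (tq E q) = q"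
    by (simp_all add: sq_def tq_def)
qed

lemma test_unique:
  assumes "is_test E" "(s, t) \<in> E"
  shows "sq E (length s) = s" "tq E (length s) = t"
proof -
  have l: "length t = length s" using assms by (auto simp: is_test_def)
  have "\<exists>!p. p \<in> E \<and> length (fst p) = length s \<and> length (snd p) = length s"
    using assms by (simp add: is_test_def)
  then have "(THE p. p \<in> E \<and> length (fst p) = length s \<and> length (snd p) = length s) = (s, t)"
    by (rule the1_equality) (use assms l in simp)
  then show "sq E (length s) = s" "tq E (length s) = t" by (simp_all add: sq_def tq_def)
qed

text \<open>The nonempty elements of \<open>test_tree E\<close>, which are those that condition (b)
  of a test can extend.\<close>

definition node :: "(bool list \<times> bool list) set \<Rightarrow> bool list \<Rightarrow> bool list \<Rightarrow> bool" where
  "node E a b \<longleftrightarrow> (\<exists>p u. a = sq E p @ False # u \<and> b = tq E p @ True # u)"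

lemma node_length:
  assumes "is_test E" "node E a b"
  shows "length b = length a" "0 < length a"
  using assms test_mem(2,3)[OF assms(1)] by (auto simp: node_def)

lemma node_append: "node E a b \<Longrightarrow> node E (a @ w) (b @ w)"
  unfolding node_def by (elim exE, rule_tac x = p in exI, rule_tac x = "u @ w" in exI) simp

text \<open>Condition (b) gives \<open>v\<close> such that \<open>(a @ v, b @ v)\<close> is in
  \<open>E\<close>. Such a pair can serve as \<open>(s_q, t_q)\<close>, so it may be followed by two
  different bits. The new difference is at position \<open>length a + length v\<close>; the 1
  subtracted accounts for the later \<open>shift\<close>.\<close>

lemma node_split:
  assumes E: "is_test E" and "node E a b"
  obtains v where "node E (a @ v @ [False]) (b @ v @ [True])" "unpair0 (length a + length v - 1) = m"
proof -
  obtain p u where pu: "a = sq E p @ False # u" "b = tq E p @ True # u"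
    using assms(2) by (auto simp: node_def)
  have "\<forall>m p u. \<exists>v. (sq E p @ [False] @ u @ v, tq E p @ [True] @ u @ v) \<in> E
                 \<and> unpair0 (length (tq E p @ [True] @ u @ v) - 1) = m"
    using E by (simp add: is_test_def)
  then obtain v where v: "(sq E p @ [False] @ u @ v, tq E p @ [True] @ u @ v) \<in> E"
    "unpair0 (length (tq E p @ [True] @ u @ v) - 1) = m" by blast
  then have mem: "(a @ v, b @ v) \<in> E" and "unpair0 (length b + length v - 1) = m"
    by (simp_all add: pu add.assoc)
  then have "unpair0 (length a + length v - 1) = m" using node_length[OF assms] by simp
  moreover have "node E (a @ v @ [False]) (b @ v @ [True])"
    unfolding node_def using test_unique[OF E mem]
    by (intro exI[of _ "length (a @ v)"] exI[of _ "[]"]) simp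
  ultimately show ?thesis using that by blast
qed

text \<open>A cut beyond \<open>p\<close> keeps the two different bits and is still a node. A
  shorter one is a cut of \<open>(s_p, t_p)\<close>, which by condition (c) is a node over a smaller
  \<open>q\<close>.\<close>

lemma node_take:
  assumes E: "is_test E" and "node E a b"
  shows "(take k a, take k b) \<in> test_tree E"
proof -
  have "(take k (sq E p @ False # u), take k (tq E p @ True # u)) \<in> test_tree E" for p u
  proof (induction p arbitrary: u rule: less_induct)
    case (less p)
    note len = test_mem(2,3)[OF E, of p]
    consider "k = 0" | "p < k" | "0 < k" "k \<le> p" by linarith
    then show ?case
    proof cases
      case 1
      then show ?thesis by (simp add: test_tree_def)
    next
      case 2
      then obtain j where "k = p + Suc j" using less_imp_Suc_add by fastforce
      then show ?thesis unfolding test_tree_def using len by auto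
    next
      case 3
      then have "0 < p" by simp
      moreover have "\<forall>n>0. \<exists>q<n. \<exists>w. sq E n = sq E q @ False # w \<and> tq E n = tq E q @ True # w"
        using E by (simp add: is_test_def)
      ultimately obtain q w where "q < p" "sq E p = sq E q @ False # w" "tq E p = tq E q @ True # w"
        by blast
      moreover have "take k (sq E p @ False # u) = take k (sq E p)"
        "take k (tq E p @ True # u) = take k (tq E p)" using 3 len by simp_all
      ultimately show ?thesis using less.IH[of q w] by simp
    qed
  qed
  then show ?thesis using assms(2) by (auto simp: node_def)
qed

text \<open>One stage of the construction: with \<open>e\<close> true, exactly one new difference
  appears, in column \<open>m\<close> after the shift; with \<open>e\<close> false, none
  does.\<close>

definition extends :: "nat \<Rightarrow> bool \<Rightarrow> bool list \<times> bool list \<Rightarrow> bool list \<times> bool list \<Rightarrow> bool" where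
  "extends m e p p' \<longleftrightarrow>
     (if e then \<exists>v w. fst p' = fst p @ v @ False # w \<and> snd p' = snd p @ v @ True # w \<and>
              unpair0 (length (fst p) + length v - 1) = m
      else \<exists>w. w \<noteq> [] \<and> fst p' = fst p @ w \<and> snd p' = snd p @ w)"

lemma ex_extends:
  assumes E: "is_test E" and U: "dense_open U" and "node E (fst p) (snd p)"
  shows "\<exists>p'. node E (fst p') (snd p') \<and> cyl (fst p') \<subseteq> U \<and> cyl (snd p') \<subseteq> U \<and> extends m e p p'"
proof -
  obtain a b where p: "p = (a, b)" by fastforce
  \<comment> \<open>The same \<open>w\<close> has to serve both words: enter \<open>U\<close> above
    \<open>a\<close> first, then lengthen until the second word enters it too. The cylinder of the
    first word only shrinks.\<close>
  have enter: "\<exists>w. cyl (a @ w) \<subseteq> U \<and> cyl (b @ w) \<subseteq> U" for a b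
  proof -
    obtain w where w: "cyl (a @ w) \<subseteq> U" using dense_open_cyl[OF U] by blast
    obtain w' where w': "cyl ((b @ w) @ w') \<subseteq> U" using dense_open_cyl[OF U] by blast
    have "cyl ((a @ w) @ w') \<subseteq> U" using cyl_append_subset w by blast
    with w' show ?thesis by (metis append.assoc)
  qed
  have ab: "node E a b" using assms(3) by (simp add: p)
  show ?thesis
  proof (cases e)
    case True
    obtain v where v: "node E (a @ v @ [False]) (b @ v @ [True])" "unpair0 (length a + length v - 1) = m"
      using node_split[OF E ab] by metis
    obtain w where w: "cyl ((a @ v @ [False]) @ w) \<subseteq> U" "cyl ((b @ v @ [True]) @ w) \<subseteq> U"
      using enter by blast
    from node_append[OF v(1), of w] w v(2) True show ?thesis
      by (intro exI[of _ "(a @ v @ False # w, b @ v @ True # w)"]) (auto simp: p extends_def)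
  next
    case False
    \<comment> \<open>The common bit \<open>False\<close> only guarantees that the extension is
      nonempty.\<close>
    obtain w where w: "cyl ((a @ [False]) @ w) \<subseteq> U" "cyl ((b @ [False]) @ w) \<subseteq> U"
      using enter by blast
    from node_append[OF ab, of "False # w"] w False show ?thesis
      by (intro exI[of _ "(a @ False # w, b @ False # w)"]) (auto simp: p extends_def)
  qed
qed

lemma extends_fst: "extends m e p p' \<Longrightarrow> \<exists>w. w \<noteq> [] \<and> fst p' = fst p @ w"
  and extends_snd: "extends m e p p' \<Longrightarrow> \<exists>w. w \<noteq> [] \<and> snd p' = snd p @ w"
  unfolding extends_def by (auto split: if_splits)

text \<open>Each word has more than \<open>n\<close> letters at stage \<open>n\<close>, so the
  diagonal \<open>a i ! i\<close> reads off the limit sequence.\<close>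

lemma chain_limit:
  fixes a :: "nat \<Rightarrow> bool list"
  assumes ext: "\<And>n. \<exists>w. w \<noteq> [] \<and> a (Suc n) = a n @ w" and "0 < length (a 0)"
  shows "n < length (a n)" "i < length (a n) \<Longrightarrow> a i ! i = a n ! i"
proof -
  have len: "n < length (a n)" for n
  proof (induction n)
    case (Suc n)
    obtain w where "w \<noteq> []" "a (Suc n) = a n @ w" using ext by blast
    with Suc show ?case by (cases w) auto
  qed (use assms(2) in simp)
  then show "n < length (a n)" .
  have keep: "i < length (a n) \<Longrightarrow> a (n + k) ! i = a n ! i \<and> i < length (a (n + k))" for i n k
  proof (induction k)
    case (Suc k)
    obtain w where "a (Suc (n + k)) = a (n + k) @ w" using ext by blast
    with Suc show ?case by (auto simp: nth_append)
  qed simp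
  show "a i ! i = a n ! i" if "i < length (a n)"
  proof (cases "i \<le> n")
    case True
    then show ?thesis using keep[OF len, of i "n - i"] by simp
  next
    case False
    then show ?thesis using keep[OF that, of "i - n"] by simp
  qed
qed

text \<open>Stage \<open>n\<close> enters \<open>D n\<close> and creates a difference in column
  \<open>unpair0 n\<close> exactly when \<open>\<epsilon> n\<close> holds. Its position within the
  column is dictated by the test, so only the set of columns containing a 1 is preserved; this is
  what \<open>rho0\<close> sees.\<close>

lemma steering:
  assumes E: "is_test E" and D: "\<And>n::nat. dense_open (D n)"
  obtains \<alpha> \<beta> :: "(nat \<Rightarrow> bool) \<Rightarrow> nat \<Rightarrow> bool" where
    "\<And>\<epsilon>. (\<alpha> \<epsilon>, \<beta> \<epsilon>) \<in> body (test_tree E)"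
    "\<And>\<epsilon>. \<alpha> \<epsilon> \<in> (\<Inter>n. D n)" "\<And>\<epsilon>. \<beta> \<epsilon> \<in> (\<Inter>n. D n)"
    "\<And>\<epsilon>. rho0 (shift (symdiff (\<alpha> \<epsilon>) (\<beta> \<epsilon>))) = rho0 \<epsilon>"
    "\<And>\<epsilon> \<epsilon>' i. \<forall>j<i. \<epsilon> j = \<epsilon>' j \<Longrightarrow> \<alpha> \<epsilon> i = \<alpha> \<epsilon>' i"
    "\<And>\<epsilon> \<epsilon>' i. \<forall>j<i. \<epsilon> j = \<epsilon>' j \<Longrightarrow> \<beta> \<epsilon> i = \<beta> \<epsilon>' i"
proof -
  define nxt where "nxt n e p = (SOME p'. node E (fst p') (snd p') \<and> cyl (fst p') \<subseteq> D n \<and>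
      cyl (snd p') \<subseteq> D n \<and> extends (unpair0 n) e p p')" for n e p
  have nxt: "node E (fst (nxt n e p)) (snd (nxt n e p))" "cyl (fst (nxt n e p)) \<subseteq> D n"
    "cyl (snd (nxt n e p)) \<subseteq> D n" "extends (unpair0 n) e p (nxt n e p)"
    if "node E (fst p) (snd p)" for n e p
    using someI_ex[OF ex_extends[OF E D that, of n "unpair0 n" e]] unfolding nxt_def by blast+
  define st where "st \<epsilon> n = rec_nat ([False], [True]) (\<lambda>n. nxt n (\<epsilon> n)) n" for \<epsilon> n
  \<comment> \<open>The starting node is the one over the empty pair of \<open>E\<close>. Its
    difference at position 0 is erased by \<open>shift\<close>.\<close>
  have st: "st \<epsilon> 0 = ([False], [True])" "st \<epsilon> (Suc n) = nxt n (\<epsilon> n) (st \<epsilon> n)" for \<epsilon> n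
    by (simp_all add: st_def)
  have nd: "node E (fst (st \<epsilon> n)) (snd (st \<epsilon> n))" for \<epsilon> n
  proof (induction n)
    case 0
    show ?case unfolding node_def st using test_mem(2,3)[OF E, of 0]
      by (intro exI[of _ 0] exI[of _ "[]"]) simp
  next
    case (Suc n)
    then show ?case by (simp add: st nxt)
  qed
  have ext: "extends (unpair0 n) (\<epsilon> n) (st \<epsilon> n) (st \<epsilon> (Suc n))" for \<epsilon> n
    using nxt(4)[OF nd] by (simp add: st)
  define \<alpha> where "\<alpha> \<epsilon> i = fst (st \<epsilon> i) ! i" for \<epsilon> i
  define \<beta> where "\<beta> \<epsilon> i = snd (st \<epsilon> i) ! i" for \<epsilon> i
  have leq: "length (snd (st \<epsilon> n)) = length (fst (st \<epsilon> n))" for \<epsilon> n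
    using node_length[OF E nd] by simp
  have len: "n < length (fst (st \<epsilon> n))" for \<epsilon> n
    by (rule chain_limit(1)[where a = "\<lambda>n. fst (st \<epsilon> n)", OF extends_fst[OF ext]]) (simp add: st)
  have a: "\<alpha> \<epsilon> i = fst (st \<epsilon> n) ! i" if "i < length (fst (st \<epsilon> n))" for \<epsilon> i n
    unfolding \<alpha>_def
    by (rule chain_limit(2)[where a = "\<lambda>n. fst (st \<epsilon> n)", OF extends_fst[OF ext]]) (use that in \<open>simp_all add: st\<close>)
  have b: "\<beta> \<epsilon> i = snd (st \<epsilon> n) ! i" if "i < length (fst (st \<epsilon> n))" for \<epsilon> i n
    unfolding \<beta>_def
    by (rule chain_limit(2)[where a = "\<lambda>n. snd (st \<epsilon> n)", OF extends_snd[OF ext]]) (use that leq in \<open>simp_all add: st\<close>)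
  have "(map (\<alpha> \<epsilon>) [0..<n], map (\<beta> \<epsilon>) [0..<n]) \<in> test_tree E" for \<epsilon> n
  proof -
    have l: "n < length (fst (st \<epsilon> n))" by (rule len)
    have "map (\<alpha> \<epsilon>) [0..<n] = take n (fst (st \<epsilon> n))"
      using l by (intro nth_equalityI) (auto intro!: a)
    moreover have "map (\<beta> \<epsilon>) [0..<n] = take n (snd (st \<epsilon> n))"
      using l leq[of \<epsilon> n] by (intro nth_equalityI) (auto intro!: b)
    ultimately show ?thesis using node_take[OF E nd] by simp
  qed
  then have in_body: "(\<alpha> \<epsilon>, \<beta> \<epsilon>) \<in> body (test_tree E)" for \<epsilon> by (simp add: body_def)
  have in_D: "\<alpha> \<epsilon> \<in> D n" "\<beta> \<epsilon> \<in> D n" for \<epsilon> n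
  proof -
    have "\<alpha> \<epsilon> \<in> cyl (fst (st \<epsilon> (Suc n)))" unfolding cyl_def using a by blast
    then show "\<alpha> \<epsilon> \<in> D n" unfolding st(2) using nxt(2)[OF nd] by blast
    have "\<beta> \<epsilon> \<in> cyl (snd (st \<epsilon> (Suc n)))" unfolding cyl_def leq using b by blast
    then show "\<beta> \<epsilon> \<in> D n" unfolding st(2) using nxt(3)[OF nd] by blast
  qed
  have rho0_eq: "rho0 (shift (symdiff (\<alpha> \<epsilon>) (\<beta> \<epsilon>))) m = rho0 \<epsilon> m" for \<epsilon> m
  proof -
    \<comment> \<open>Any difference past position 0 was created at a stage \<open>n'\<close> with
      \<open>\<epsilon> n'\<close>, in the column of \<open>n'\<close>. The induction goes back to
      the stage at which position \<open>Suc q\<close> was added.\<close>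
    have "\<exists>n'. \<epsilon> n' \<and> unpair0 n' = unpair0 q"
      if "Suc q < length (fst (st \<epsilon> n))" "fst (st \<epsilon> n) ! Suc q \<noteq> snd (st \<epsilon> n) ! Suc q" for n q
      using that
    proof (induction n)
      case 0
      then show ?case by (simp add: st)
    next
      case (Suc n)
      let ?l = "length (fst (st \<epsilon> n))"
      show ?case
      proof (cases "Suc q < ?l")
        case True
        moreover have "fst (st \<epsilon> (Suc n)) ! Suc q = fst (st \<epsilon> n) ! Suc q"
          using a[OF True] a[OF Suc.prems(1)] by simp
        moreover have "snd (st \<epsilon> (Suc n)) ! Suc q = snd (st \<epsilon> n) ! Suc q"
          using b[OF True] b[OF Suc.prems(1)] by simp
        ultimately show ?thesis using Suc by simp
      next
        case False
        have "\<epsilon> n"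
        proof (rule ccontr)
          assume "\<not> \<epsilon> n"
          then obtain w where "fst (st \<epsilon> (Suc n)) = fst (st \<epsilon> n) @ w" "snd (st \<epsilon> (Suc n)) = snd (st \<epsilon> n) @ w"
            using ext[of n \<epsilon>] by (auto simp: extends_def)
          then show False using Suc.prems(2) False leq[of \<epsilon> n] by (simp add: nth_append)
        qed
        then obtain v w where vw: "fst (st \<epsilon> (Suc n)) = fst (st \<epsilon> n) @ v @ False # w"
          "snd (st \<epsilon> (Suc n)) = snd (st \<epsilon> n) @ v @ True # w" "unpair0 (?l + length v - 1) = unpair0 n"
          using ext[of n \<epsilon>] by (auto simp: extends_def)
        \<comment> \<open>The added block has a single difference, right after \<open>v\<close>;
          before and after it the two words receive the same letters.\<close>
        have "Suc q = ?l + length v"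
        proof (rule ccontr)
          assume ne: "Suc q \<noteq> ?l + length v"
          show False
          proof (cases "Suc q - ?l < length v")
            case True
            then show ?thesis using Suc.prems(2) False leq[of \<epsilon> n] unfolding vw(1,2) by (simp add: nth_append)
          next
            case ge: False
            then have "length v < Suc q - ?l" using ne False by linarith
            then obtain j where "Suc q - ?l = Suc (length v + j)" using less_imp_Suc_add by blast
            then show ?thesis using Suc.prems(2) False leq[of \<epsilon> n] unfolding vw(1,2) by (simp add: nth_append)
          qed
        qed
        then have "q = ?l + length v - 1" by simp
        with vw(3) \<open>\<epsilon> n\<close> show ?thesis by auto
      qed
    qed
    then have 1: "\<exists>n'. \<epsilon> n' \<and> unpair0 n' = unpair0 q" if "shift (symdiff (\<alpha> \<epsilon>) (\<beta> \<epsilon>)) q" for q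
      using that len[of "Suc q" \<epsilon>] by (auto simp: shift_def symdiff_def \<alpha>_def \<beta>_def)
    have 2: "\<exists>q. shift (symdiff (\<alpha> \<epsilon>) (\<beta> \<epsilon>)) q \<and> unpair0 q = unpair0 n" if "\<epsilon> n" for n
    proof -
      let ?l = "length (fst (st \<epsilon> n))"
      obtain v w where vw: "fst (st \<epsilon> (Suc n)) = fst (st \<epsilon> n) @ v @ False # w"
        "snd (st \<epsilon> (Suc n)) = snd (st \<epsilon> n) @ v @ True # w" "unpair0 (?l + length v - 1) = unpair0 n"
        using ext[of n \<epsilon>] \<open>\<epsilon> n\<close> by (auto simp: extends_def)
      obtain q where q: "?l + length v = Suc q" using len[of n \<epsilon>] by (cases "?l + length v") auto
      have lq: "Suc q < length (fst (st \<epsilon> (Suc n)))" unfolding vw(1) q[symmetric] by simp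
      have "fst (st \<epsilon> (Suc n)) ! Suc q = False"
        unfolding vw(1) q[symmetric] by (simp add: nth_append)
      then have "\<alpha> \<epsilon> (Suc q) = False" using a[OF lq] by simp
      moreover have "snd (st \<epsilon> (Suc n)) ! Suc q = True"
        unfolding vw(2) q[symmetric] using leq[of \<epsilon> n] by (simp add: nth_append)
      then have "\<beta> \<epsilon> (Suc q) = True" using b[OF lq] by simp
      moreover have "unpair0 q = unpair0 n" using vw(3) q by simp
      ultimately show ?thesis by (auto simp: shift_def symdiff_def)
    qed
    show ?thesis
      unfolding rho0_def using 1 2 ex_pair by (metis unpair0_pair)
  qed
  have agree: "st \<epsilon> i = st \<epsilon>' i" if "\<forall>j<i. \<epsilon> j = \<epsilon>' j" for \<epsilon> \<epsilon>' i
    using that by (induction i) (simp_all add: st)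
  show ?thesis
  proof (rule that[of \<alpha> \<beta>])
    show "rho0 (shift (symdiff (\<alpha> \<epsilon>) (\<beta> \<epsilon>))) = rho0 \<epsilon>" for \<epsilon>
      using rho0_eq by blast
    show "\<alpha> \<epsilon> i = \<alpha> \<epsilon>' i" "\<beta> \<epsilon> i = \<beta> \<epsilon>' i" if "\<forall>j<i. \<epsilon> j = \<epsilon>' j" for \<epsilon> \<epsilon>' i
      using agree[OF that] by (simp_all add: \<alpha>_def \<beta>_def)
  qed (use in_body in_D in simp_all)
qed

section \<open>Reducing H to the complement of S\<close>

text \<open>For nonzero \<open>\<xi>\<close> the first map applied to the input is always
  \<open>rho0\<close>. At a limit, \<open>seq \<xi> 0\<close> is nonzero, so stage 0 already
  identifies \<open>x\<close> and \<open>y\<close>, and later stages see only its outcome.\<close>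

lemma rho_cong_rho0:
  fixes seq :: "'o::wellorder \<Rightarrow> nat \<Rightarrow> 'o"
  assumes good: "good_seq seq \<xi>\<^sub>0" and xy: "rho0 x = rho0 y"
  shows "\<xi> \<le> \<xi>\<^sub>0 \<Longrightarrow> \<not> is_zero \<xi> \<Longrightarrow> rho seq \<xi> x = rho seq \<xi> y"
proof (induction \<xi> rule: less_induct)
  case (less \<xi>)
  show ?case
  proof (cases "is_succ \<xi>")
    case True
    show ?thesis
    proof (cases "is_zero (opred \<xi>)")
      case False
      then have "rho seq (opred \<xi>) x = rho seq (opred \<xi>) y"
        using less.IH[OF opred_max(1)[OF True]] opred_max(1)[OF True] less.prems(1) by simp
      then show ?thesis by (simp add: rho_succ[OF True])
    qed (simp add: rho_succ[OF True] rho_zero xy)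
  next
    case False
    with less.prems(2) have lim: "is_limit \<xi>" by (simp add: is_limit_def)
    have sq: "\<And>k. \<not> is_zero (seq \<xi> k)" "\<And>k. seq \<xi> k < \<xi>"
      using good less.prems(1) lim by (auto simp: good_seq_def)
    define M where "M = Mseq (\<lambda>k. rho seq (seq \<xi> k))"
    have "rho seq (seq \<xi> 0) x = rho seq (seq \<xi> 0) y"
      using less.IH[OF sq(2) _ sq(1)] sq(2)[of 0] less.prems(1) by simp
    then have "rho seq (seq \<xi> k) (M x k) = rho seq (seq \<xi> k) (M y k)" for k
      by (induction k) (simp_all add: M_def)
    then have "rho seq \<xi> x k = rho seq \<xi> y k" for k
      unfolding rho_limit[where seq = seq, OF lim sq(2)] M_def by simp
    then show ?thesis by blast
  qed
qed

text \<open>At level zero rho is the identity, which \<open>rho0\<close> does not determine.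
  However, being constantly 0 amounts to having no 1 in any column, which \<open>rho0\<close> does
  detect.\<close>

lemma H_cong_rho0:
  fixes seq :: "'o::wellorder \<Rightarrow> nat \<Rightarrow> 'o"
  assumes "good_seq seq \<xi>" and xy: "rho0 x = rho0 y"
  shows "x \<in> H seq \<xi> \<longleftrightarrow> y \<in> H seq \<xi>"
proof (cases "is_zero \<xi>")
  case True
  have "z = (\<lambda>_. False) \<longleftrightarrow> rho0 z = (\<lambda>_. True)" for z
  proof
    assume z: "rho0 z = (\<lambda>_. True)"
    have "\<not> z q" for q
    proof -
      obtain p where "q = pair (unpair0 q) p" using ex_pair by blast
      then show ?thesis using fun_cong[OF z, of "unpair0 q"] by (metis rho0_def)
    qed
    then show "z = (\<lambda>_. False)" by auto
  qed (auto simp: rho0_def)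
  with xy True show ?thesis by (simp add: H_def rho_zero)
next
  case False
  then show ?thesis using rho_cong_rho0[OF assms order_refl] by (simp add: H_def)
qed

text \<open>Dependence on finite prefixes gives continuity into the usual topology. On
  \<open>C\<close>, which contains all values of \<open>\<alpha>\<close>, the open sets of
  \<open>\<sigma>\<close> are traces of usual open sets.\<close>

lemma continuous_map_into_finer:
  assumes fin: "finer \<sigma> cantor_top"
    and agree: "\<And>U. openin \<sigma> U \<Longrightarrow> \<exists>V. openin cantor_top V \<and> U \<inter> C = V \<inter> C"
    and C: "\<And>\<epsilon>. \<alpha> \<epsilon> \<in> C"
    and loc: "\<And>\<epsilon> \<epsilon>' i. \<forall>j<i. \<epsilon> j = \<epsilon>' j \<Longrightarrow> \<alpha> \<epsilon> i = \<alpha> \<epsilon>' i"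
  shows "continuous_map cantor_top \<sigma> \<alpha>"
  unfolding continuous_map
proof (intro conjI allI impI)
  show "\<alpha> ` topspace cantor_top \<subseteq> topspace \<sigma>" using fin by (simp add: finer_def)
  fix U assume "openin \<sigma> U"
  then obtain V where V: "openin cantor_top V" "U \<inter> C = V \<inter> C" using agree by blast
  then have UV: "\<alpha> \<epsilon> \<in> U \<longleftrightarrow> \<alpha> \<epsilon> \<in> V" for \<epsilon> using C by blast
  show "openin cantor_top {\<epsilon> \<in> topspace cantor_top. \<alpha> \<epsilon> \<in> U}"
    unfolding openin_cantor_iff
  proof
    fix \<epsilon> assume "\<epsilon> \<in> {\<epsilon> \<in> topspace cantor_top. \<alpha> \<epsilon> \<in> U}"
    then obtain n where n: "\<forall>y. (\<forall>i<n. y i = \<alpha> \<epsilon> i) \<longrightarrow> y \<in> V"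
      using V(1) UV unfolding openin_cantor_iff by blast
    have "\<alpha> \<epsilon>' \<in> U" if "\<forall>i<n. \<epsilon>' i = \<epsilon> i" for \<epsilon>'
    proof -
      have "\<alpha> \<epsilon>' i = \<alpha> \<epsilon> i" if "i < n" for i
        by (rule loc) (use \<open>i < n\<close> \<open>\<forall>i<n. \<epsilon>' i = \<epsilon> i\<close> in auto)
      then show ?thesis using n UV by blast
    qed
    then show "\<exists>n. \<forall>\<epsilon>'. (\<forall>i<n. \<epsilon>' i = \<epsilon> i) \<longrightarrow> \<epsilon>' \<in> {\<epsilon> \<in> topspace cantor_top. \<alpha> \<epsilon> \<in> U}"
      by (intro exI[of _ n]) simp
  qed
qed

lemma reduction:
  fixes seq :: "'o::wellorder \<Rightarrow> nat \<Rightarrow> 'o"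
  assumes E: "is_test E" and good: "good_seq seq \<xi>"
    and pol: "Polish_space \<sigma>" "Polish_space \<tau>"
    and fin: "finer \<sigma> cantor_top" "finer \<tau> cantor_top"
  obtains f where "continuous_map cantor_top (prod_topology \<sigma> \<tau>) f"
    "\<And>\<epsilon>. f \<epsilon> \<in> body (test_tree E)" "\<And>\<epsilon>. f \<epsilon> \<in> S_set seq E \<xi> \<longleftrightarrow> \<epsilon> \<notin> H seq \<xi>"
proof -
  from Polish_finer_agree[OF pol(1) fin(1)]
  obtain D1 :: "nat \<Rightarrow> _" where "(\<forall>n. dense_open (D1 n)) \<and>
    (\<forall>U. openin \<sigma> U \<longrightarrow> (\<exists>V. openin cantor_top V \<and> U \<inter> (\<Inter>n. D1 n) = V \<inter> (\<Inter>n. D1 n)))" ..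
  then have D1: "\<And>n. dense_open (D1 n)"
    "\<And>U. openin \<sigma> U \<Longrightarrow> \<exists>V. openin cantor_top V \<and> U \<inter> (\<Inter>n. D1 n) = V \<inter> (\<Inter>n. D1 n)"
    by simp_all
  from Polish_finer_agree[OF pol(2) fin(2)]
  obtain D2 :: "nat \<Rightarrow> _" where "(\<forall>n. dense_open (D2 n)) \<and>
    (\<forall>U. openin \<tau> U \<longrightarrow> (\<exists>V. openin cantor_top V \<and> U \<inter> (\<Inter>n. D2 n) = V \<inter> (\<Inter>n. D2 n)))" ..
  then have D2: "\<And>n. dense_open (D2 n)"
    "\<And>U. openin \<tau> U \<Longrightarrow> \<exists>V. openin cantor_top V \<and> U \<inter> (\<Inter>n. D2 n) = V \<inter> (\<Inter>n. D2 n)"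
    by simp_all
  \<comment> \<open>Steering through \<open>D1 n \<inter> D2 n\<close> keeps both components in both
    comeager sets, so one sequence of dense open sets handles the two topologies.\<close>
  obtain \<alpha> \<beta> where ab: "\<And>\<epsilon>. (\<alpha> \<epsilon>, \<beta> \<epsilon>) \<in> body (test_tree E)"
    "\<And>\<epsilon>. \<alpha> \<epsilon> \<in> (\<Inter>n. D1 n \<inter> D2 n)" "\<And>\<epsilon>. \<beta> \<epsilon> \<in> (\<Inter>n. D1 n \<inter> D2 n)"
    "\<And>\<epsilon>. rho0 (shift (symdiff (\<alpha> \<epsilon>) (\<beta> \<epsilon>))) = rho0 \<epsilon>"
    "\<And>\<epsilon> \<epsilon>' i. \<forall>j<i. \<epsilon> j = \<epsilon>' j \<Longrightarrow> \<alpha> \<epsilon> i = \<alpha> \<epsilon>' i"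
    "\<And>\<epsilon> \<epsilon>' i. \<forall>j<i. \<epsilon> j = \<epsilon>' j \<Longrightarrow> \<beta> \<epsilon> i = \<beta> \<epsilon>' i"
    by (rule steering[OF E dense_open_Int[OF D1(1) D2(1)]]) (rule that)
  have "continuous_map cantor_top \<sigma> \<alpha>"
    by (rule continuous_map_into_finer[OF fin(1) D1(2) _ ab(5)]) (use ab(2) in auto)
  moreover have "continuous_map cantor_top \<tau> \<beta>"
    by (rule continuous_map_into_finer[OF fin(2) D2(2) _ ab(6)]) (use ab(3) in auto)
  ultimately have "continuous_map cantor_top (prod_topology \<sigma> \<tau>) (\<lambda>\<epsilon>. (\<alpha> \<epsilon>, \<beta> \<epsilon>))"
    by (simp add: continuous_map_pairedI)
  moreover have "(\<alpha> \<epsilon>, \<beta> \<epsilon>) \<in> S_set seq E \<xi> \<longleftrightarrow> \<epsilon> \<notin> H seq \<xi>" for \<epsilon>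
    using ab(1)[of \<epsilon>] H_cong_rho0[OF good ab(4)] by (simp add: S_set_def)
  ultimately show ?thesis using ab(1) by (intro that) auto
qed

theorem theorem3p5:
  fixes E :: "(bool list \<times> bool list) set"
    and seq :: "'o::wellorder \<Rightarrow> nat \<Rightarrow> 'o"
    and \<xi> :: "'o"
  assumes "is_test E"
    and "countable {..<\<xi>}"
    and "good_seq seq \<xi>"
  shows "body (test_tree E) - S_set seq E \<xi> \<in> pi0 (prod_topology cantor_top cantor_top) \<xi>
       \<and> \<not> pot (\<lambda>Z. sigma0 Z \<xi>) cantor_top cantor_top (body (test_tree E) - S_set seq E \<xi>)
       \<and> \<not> pot (\<lambda>Z. pi0 Z \<xi>) cantor_top cantor_top (S_set seq E \<xi>)"
proof (intro conjI notI)
  show "body (test_tree E) - S_set seq E \<xi> \<in> pi0 (prod_topology cantor_top cantor_top) \<xi>"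
    by (rule body_diff_S_set_pi0[OF assms(3)])
next
  assume "pot (\<lambda>Z. sigma0 Z \<xi>) cantor_top cantor_top (body (test_tree E) - S_set seq E \<xi>)"
  then obtain \<sigma> \<tau> where top: "Polish_space \<sigma>" "Polish_space \<tau>" "finer \<sigma> cantor_top" "finer \<tau> cantor_top"
    and A: "body (test_tree E) - S_set seq E \<xi> \<in> sigma0 (prod_topology \<sigma> \<tau>) \<xi>"
    by (auto simp: pot_def)
  obtain f where f: "continuous_map cantor_top (prod_topology \<sigma> \<tau>) f"
    "\<And>\<epsilon>. f \<epsilon> \<in> body (test_tree E)" "\<And>\<epsilon>. f \<epsilon> \<in> S_set seq E \<xi> \<longleftrightarrow> \<epsilon> \<notin> H seq \<xi>"
    using reduction[OF assms(1,3) top] by blast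
  have "{\<epsilon> \<in> topspace cantor_top. f \<epsilon> \<in> body (test_tree E) - S_set seq E \<xi>} = H seq \<xi>"
    using f(2,3) by auto
  then show False using sigma0_preimage[OF f(1) A] H_notin_sigma0[OF assms(3)] by simp
next
  assume "pot (\<lambda>Z. pi0 Z \<xi>) cantor_top cantor_top (S_set seq E \<xi>)"
  then obtain \<sigma> \<tau> where top: "Polish_space \<sigma>" "Polish_space \<tau>" "finer \<sigma> cantor_top" "finer \<tau> cantor_top"
    and A: "S_set seq E \<xi> \<in> pi0 (prod_topology \<sigma> \<tau>) \<xi>"
    by (auto simp: pot_def)
  obtain f where f: "continuous_map cantor_top (prod_topology \<sigma> \<tau>) f"
    "\<And>\<epsilon>. f \<epsilon> \<in> body (test_tree E)" "\<And>\<epsilon>. f \<epsilon> \<in> S_set seq E \<xi> \<longleftrightarrow> \<epsilon> \<notin> H seq \<xi>"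
    using reduction[OF assms(1,3) top] by blast
  have "topspace (prod_topology \<sigma> \<tau>) = UNIV" using top(3,4) by (simp add: finer_def)
  then have eq: "{\<epsilon> \<in> topspace cantor_top. f \<epsilon> \<in> topspace (prod_topology \<sigma> \<tau>) - S_set seq E \<xi>} = H seq \<xi>"
    using f(3) by auto
  have mem: "topspace (prod_topology \<sigma> \<tau>) - S_set seq E \<xi> \<in> sigma0 (prod_topology \<sigma> \<tau>) \<xi>"
    using A by (simp add: pi0_iff)
  show False using sigma0_preimage[OF f(1) mem] H_notin_sigma0[OF assms(3)] unfolding eq by blast
qed

end
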